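(* Let $n\ge1$. For every indecomposable permutation $\theta\in\mathcal S_{n+1}$, the pair $\Psi(\theta)=(\sigma,\alpha)$ is a hypermap with darts $\{1,\dots,n\}$, and the map sending $\theta$ to the rooted isomorphism class of $\Psi(\theta)$ is a bijection between the set of indecomposable permutations of $\mathcal S_{n+1}$ and the set of rooted hypermaps with darts $1,\dots,n$. Moreover, for $(\sigma,\alpha)=\Psi(\theta)$, $\alpha$ and $\theta$ have the same number of cycles, and the number of cycles of $\sigma$ equals the number of left-to-right maxima of $\theta$.
   Context: Permutations are written as sequences $a_1,\dots,a_m$ with $a_i$ the image of $i$. A permutation is decomposable if there is $p<m$ with $1\le a_i\le p$ for all $i\le p$, indecomposable otherwise. $a_i$ is a left-to-right maximum if $a_j<a_i$ for all $j<i$. A hypermap with darts $\{1,\dots,n\}$ is a pair $(\sigma,\alpha)$ of permutations of $\{1,\dots,n\}$ generating a group acting transitively on $\{1,\dots,n\}$. Two hypermaps $(\sigma,\alpha),(\sigma',\alpha')$ are isomorphic as rooted hypermaps if some permutation $\phi$ with $\phi(n)=n$ satisfies $\phi^{-1}\alpha\phi=\alpha'$, $\phi^{-1}\sigma\phi=\sigma'$; rooted hypermaps are the equivalence classes. The map $\Psi$ (algorithm OMR): given an indecomposable $\theta=a_1,\dots,a_{n+1}\in\mathcal S_{n+1}$, let $1=i_1<i_2<\dots<i_k$ be the indices of the left-to-right maxima of $\theta$ (so $a_{i_k}=n+1$); let $\sigma_1=(1,\dots,i_2-1)(i_2,\dots,i_3-1)\cdots(i_k,\dots,n+1)$; then $\alpha$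 and $\sigma$ are obtained from $\theta$ and $\sigma_1$ respectively by deleting $n+1$ from its cycle (the predecessor of $n+1$ is sent to the successor of $n+1$), and $\Psi(\theta)=(\sigma,\alpha)$. *)

theory Defs
  imports "HOL-Algebra.Sym_Groups" "HOL-Combinatorics.Orbits"
begin

definition decomposable :: "nat \<Rightarrow> (nat \<Rightarrow> nat) \<Rightarrow> bool" where
  "decomposable m \<theta> \<longleftrightarrow> (\<exists>p\<in>{1..<m}. \<forall>i\<in>{1..p}. 1 \<le> \<theta> i \<and> \<theta> i \<le> p)"

definition indecomposables :: "nat \<Rightarrow> (nat \<Rightarrow> nat) set" where
  "indecomposables m = {\<theta> \<in> carrier (sym_group m). \<not> decomposable m \<theta>}"

definition lr_max_indices :: "nat \<Rightarrow> (nat \<Rightarrow> nat) \<Rightarrow> nat set" where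
  "lr_max_indices m \<theta> = {i \<in> {1..m}. \<forall>j\<in>{1..<i}. \<theta> j < \<theta> i}"

text \<open>Cycles are the orbits on \<open>{1..m}\<close>, so fixed points count as cycles of length one.\<close>

definition num_cycles :: "nat \<Rightarrow> (nat \<Rightarrow> nat) \<Rightarrow> nat" where
  "num_cycles m p = card (orbit p ` {1..m})"

definition hypermaps :: "nat \<Rightarrow> ((nat \<Rightarrow> nat) \<times> (nat \<Rightarrow> nat)) set" where
  "hypermaps n = {(\<sigma>, \<alpha>). \<sigma> \<in> carrier (sym_group n) \<and> \<alpha> \<in> carrier (sym_group n) \<and>
     (\<forall>x\<in>{1..n}. \<forall>y\<in>{1..n}. \<exists>g \<in> generate (sym_group n) {\<sigma>, \<alpha>}. g x = y)}"

text \<open>The dart \<open>n\<close> is the root. Reading the product in \<open>\<phi>\<^sup>-\<^sup>1 \<alpha> \<phi>\<close> from left to right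
  instead amounts to replacing \<open>\<phi>\<close> by its inverse, and so gives the same relation.\<close>

definition rooted_iso ::
    "nat \<Rightarrow> (((nat \<Rightarrow> nat) \<times> (nat \<Rightarrow> nat)) \<times> ((nat \<Rightarrow> nat) \<times> (nat \<Rightarrow> nat))) set" where
  "rooted_iso n = {((\<sigma>, \<alpha>), (\<sigma>', \<alpha>')).
     (\<sigma>, \<alpha>) \<in> hypermaps n \<and> (\<sigma>', \<alpha>') \<in> hypermaps n \<and>
     (\<exists>\<phi> \<in> carrier (sym_group n). \<phi> n = n \<and>
        inv' \<phi> \<circ> \<alpha> \<circ> \<phi> = \<alpha>' \<and> inv' \<phi> \<circ> \<sigma> \<circ> \<phi> = \<sigma>')}"

lemma equiv_rooted_iso: "equiv (hypermaps n) (rooted_iso n)"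
proof (rule equivI)
  show "rooted_iso n \<subseteq> hypermaps n \<times> hypermaps n"
    by (auto simp: rooted_iso_def)
  show "refl_on (hypermaps n) (rooted_iso n)"
    by (auto simp: refl_on_def rooted_iso_def sym_group_carrier
        intro!: bexI[of _ id] permutes_id)
  show "sym (rooted_iso n)"
  proof (rule symI, clarify)
    fix \<sigma> \<alpha> \<sigma>' \<alpha>' assume "((\<sigma>, \<alpha>), (\<sigma>', \<alpha>')) \<in> rooted_iso n"
    then obtain \<phi> where h: "(\<sigma>, \<alpha>) \<in> hypermaps n" "(\<sigma>', \<alpha>') \<in> hypermaps n"
      and \<phi>: "\<phi> permutes {1..n}" "\<phi> n = n"
      and eq: "\<alpha>' = inv' \<phi> \<circ> \<alpha> \<circ> \<phi>" "\<sigma>' = inv' \<phi> \<circ> \<sigma> \<circ> \<phi>"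
      by (auto simp: rooted_iso_def sym_group_carrier)
    have "inv' (inv' \<phi>) \<circ> (inv' \<phi> \<circ> \<beta> \<circ> \<phi>) \<circ> inv' \<phi> = \<beta>" for \<beta>
      using \<phi>(1) by (auto simp: fun_eq_iff permutes_inverses permutes_inv_inv)
    moreover have "inv' \<phi> n = n" using \<phi> by (metis permutes_inverses(2))
    ultimately show "((\<sigma>', \<alpha>'), (\<sigma>, \<alpha>)) \<in> rooted_iso n"
      unfolding rooted_iso_def using h \<phi>(1)
      by (auto simp: sym_group_carrier eq intro!: bexI[of _ "inv' \<phi>"] permutes_inv)
  qed
  show "trans (rooted_iso n)"
  proof (rule transI, clarify)
    fix \<sigma> \<alpha> \<sigma>' \<alpha>' \<sigma>'' \<alpha>''
    assume "((\<sigma>, \<alpha>), (\<sigma>', \<alpha>')) \<in> rooted_iso n" "((\<sigma>', \<alpha>'), (\<sigma>'', \<alpha>'')) \<in> rooted_iso n"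
    then obtain \<phi> \<psi> where h: "(\<sigma>, \<alpha>) \<in> hypermaps n" "(\<sigma>'', \<alpha>'') \<in> hypermaps n"
      and \<phi>: "\<phi> permutes {1..n}" "\<phi> n = n"
      and \<psi>: "\<psi> permutes {1..n}" "\<psi> n = n"
      and eq: "\<alpha>' = inv' \<phi> \<circ> \<alpha> \<circ> \<phi>" "\<sigma>' = inv' \<phi> \<circ> \<sigma> \<circ> \<phi>"
        "\<alpha>'' = inv' \<psi> \<circ> \<alpha>' \<circ> \<psi>" "\<sigma>'' = inv' \<psi> \<circ> \<sigma>' \<circ> \<psi>"
      by (auto simp: rooted_iso_def sym_group_carrier)
    have "inv' (\<phi> \<circ> \<psi>) = inv' \<psi> \<circ> inv' \<phi>"
      using \<phi>(1) \<psi>(1) by (simp add: o_inv_distrib permutes_bij)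
    then show "((\<sigma>, \<alpha>), (\<sigma>'', \<alpha>'')) \<in> rooted_iso n"
      unfolding rooted_iso_def using h \<phi> \<psi>
      by (auto simp: sym_group_carrier eq comp_assoc
          intro!: bexI[of _ "\<phi> \<circ> \<psi>"] permutes_compose)
  qed
qed

definition rooted_hypermaps :: "nat \<Rightarrow> ((nat \<Rightarrow> nat) \<times> (nat \<Rightarrow> nat)) set set" where
  "rooted_hypermaps n = hypermaps n // rooted_iso n"

text \<open>The product of the disjoint cycles \<open>(i\<^sub>1, \<dots>, i\<^sub>2 - 1) (i\<^sub>2, \<dots>, i\<^sub>3 - 1) \<dots> (i\<^sub>k, \<dots>, m)\<close>,
  where \<open>i\<^sub>1 < \<dots> < i\<^sub>k\<close> are the indices of the left-to-right maxima of \<open>\<theta>\<close>.\<close>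

definition omr_cycles :: "nat \<Rightarrow> (nat \<Rightarrow> nat) \<Rightarrow> nat \<Rightarrow> nat" where
  "omr_cycles m \<theta> =
     (let is = sorted_list_of_set (lr_max_indices m \<theta>)
      in foldr (\<lambda>(i, j) p. cycle_of_list [i..<j] \<circ> p) (zip is (tl is @ [m + 1])) id)"

definition delete_point :: "nat \<Rightarrow> (nat \<Rightarrow> nat) \<Rightarrow> nat \<Rightarrow> nat" where
  "delete_point m p = (\<lambda>x. if x = m then m else if p x = m then p m else p x)"

definition Psi :: "nat \<Rightarrow> (nat \<Rightarrow> nat) \<Rightarrow> (nat \<Rightarrow> nat) \<times> (nat \<Rightarrow> nat)" where
  "Psi n \<theta> = (delete_point (n + 1) (omr_cycles (n + 1) \<theta>), delete_point (n + 1) \<theta>)"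

end

theory Submission
  imports Defs
begin

text \<open>
  Put \<open>N = n + 1\<close> and let \<open>\<sigma>\<^sub>1\<close> be the product of the block cycles of \<open>\<theta>\<close>. The deletions lose
  nothing: if \<open>\<theta>\<close> is indecomposable then \<open>\<sigma>\<^sub>1 n = N\<close> and \<open>\<theta> (\<sigma>\<^sub>1 N) = N\<close>, so \<open>\<sigma>\<^sub>1\<close> and \<open>\<theta>\<close>
  are recovered from \<open>(\<sigma>, \<alpha>)\<close> by inserting \<open>N\<close> after \<open>n\<close> in \<open>\<sigma>\<close> and after \<open>\<sigma> n\<close> in \<open>\<alpha>\<close>, and
  rooted isomorphisms extend by fixing \<open>N\<close>. The blocks of \<open>\<theta>\<close> can be read off downwards from
  \<open>N\<close>: the block below \<open>i\<close> starts at the point of \<open>{1..<i}\<close> with the largest image, and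
  indecomposability says exactly that this image is at least \<open>i\<close>. Hence a labelling comes from an
  indecomposable permutation iff it lists the points in the order of this traversal. The traversal
  is determined by the unlabelled rooted structure, which gives injectivity; when the group
  is transitive it does not stop before all points are visited, which gives surjectivity.
\<close>

section \<open>Transitivity expressed by invariant sets\<close>

text \<open>For permutations of \<open>X = {1..n}\<close> this amounts to transitivity of the
  generated group. Invariant subsets avoid words in the generators and are easy to carry through
  relabelling, deletion and insertion of a point.\<close>

definition connected_on :: "nat set \<Rightarrow> (nat \<Rightarrow> nat) \<Rightarrow> (nat \<Rightarrow> nat) \<Rightarrow> bool" where
  "connected_on X \<sigma> \<theta> \<longleftrightarrow> (\<forall>A\<subseteq>X. A \<noteq> {} \<longrightarrow> \<sigma> ` A \<subseteq> A \<longrightarrow> \<theta> ` A \<subseteq> A \<longrightarrow> A = X)"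

text \<open>An injection of a finite set into itself is onto, so forward invariance is also backward
  invariance.\<close>

lemma permutes_invariant_iff:
  assumes "p permutes S" "finite A" "p ` A \<subseteq> A"
  shows "p x \<in> A \<longleftrightarrow> x \<in> A"
proof -
  have "p ` A = A"
    using assms by (intro endo_inj_surj) (auto intro: permutes_inj_on)
  then show ?thesis
    using assms(1) by (metis inj_image_mem_iff permutes_inj)
qed

text \<open>A set invariant under the generators is invariant under the whole group, inverses being
  covered by finiteness. Conversely the group orbit of a point is a nonempty invariant set.\<close>

lemma hypermaps_iff_connected_on:
  "(\<sigma>, \<alpha>) \<in> hypermaps n \<longleftrightarrow>
    \<sigma> permutes {1..n} \<and> \<alpha> permutes {1..n} \<and> connected_on {1..n} \<sigma> \<alpha>"
proof -
  let ?gen = "generate (sym_group n) {\<sigma>, \<alpha>}"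
  have "(\<forall>x\<in>{1..n}. \<forall>y\<in>{1..n}. \<exists>g \<in> ?gen. g x = y) \<longleftrightarrow> connected_on {1..n} \<sigma> \<alpha>"
    if p: "\<sigma> permutes {1..n}" "\<alpha> permutes {1..n}"
  proof
    assume trans: "\<forall>x\<in>{1..n}. \<forall>y\<in>{1..n}. \<exists>g \<in> ?gen. g x = y"
    show "connected_on {1..n} \<sigma> \<alpha>"
      unfolding connected_on_def
    proof (intro allI impI)
      fix A assume A: "A \<subseteq> {1..n}" "A \<noteq> {}" "\<sigma> ` A \<subseteq> A" "\<alpha> ` A \<subseteq> A"
      then obtain x where x: "x \<in> A" by blast
      have fin: "finite A" using A(1) finite_subset by blast
      have closed: "g ` A \<subseteq> A" if "g \<in> ?gen" for g
        using that
      proof induction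
        case one
        then show ?case by (simp add: sym_group_one)
      next
        case (incl h)
        then show ?case using A by blast
      next
        case (inv h)
        then have h: "h permutes {1..n}" "h ` A \<subseteq> A" using p A by auto
        then have "inv\<^bsub>sym_group n\<^esub> h = inv' h"
          by (simp add: sym_group_carrier sym_group_inv_equality)
        moreover have "inv' h y \<in> A" if "y \<in> A" for y
          using permutes_invariant_iff[OF h(1) fin h(2), of "inv' h y"] that h(1)
          by (simp add: permutes_inverses)
        ultimately show ?case by auto
      next
        case (eng g h)
        then show ?case by (auto simp: sym_group_mult)
      qed
      have "y \<in> A" if "y \<in> {1..n}" for y
        using trans closed that x A(1) by (metis image_subset_iff subsetD)
      then show "A = {1..n}" using A(1) by auto
    qed
  next
    assume conn: "connected_on {1..n} \<sigma> \<alpha>"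
    show "\<forall>x\<in>{1..n}. \<forall>y\<in>{1..n}. \<exists>g \<in> ?gen. g x = y"
    proof (intro ballI)
      fix x y assume x: "x \<in> {1..n}" and y: "y \<in> {1..n}"
      let ?A = "(\<lambda>g. g x) ` ?gen"
      have closed: "h ` ?A \<subseteq> ?A" if "h \<in> {\<sigma>, \<alpha>}" for h
      proof -
        have "h \<circ> g \<in> ?gen" if "g \<in> ?gen" for g
          using generate.eng[OF generate.incl[OF \<open>h \<in> {\<sigma>, \<alpha>}\<close>] that] by (simp add: sym_group_mult)
        then show ?thesis by (auto simp: image_image) (metis comp_apply imageI)
      qed
      have "?gen \<subseteq> carrier (sym_group n)"
        using p by (intro group.generate_incl sym_group_is_group) (auto simp: sym_group_carrier)
      then have "?A \<subseteq> {1..n}"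
        using x by (auto simp: sym_group_carrier subset_iff dest!: permutes_in_image[of _ _ x])
      moreover have "?A \<noteq> {}" using generate.one by fast
      ultimately have "?A = {1..n}"
        using conn closed unfolding connected_on_def by simp
      then have "y \<in> ?A" using y by simp
      then show "\<exists>g \<in> ?gen. g x = y" by auto
    qed
  qed
  then show ?thesis by (auto simp: hypermaps_def sym_group_carrier)
qed

section \<open>Deleting a point\<close>

lemma delete_point_eq_transpose: "delete_point m p = transpose m (p m) \<circ> p" if "inj p"
  using that by (auto simp: fun_eq_iff delete_point_def transpose_def inj_eq)

lemma delete_point_permutes:
  assumes "p permutes {1..Suc n}"
  shows "delete_point (Suc n) p permutes {1..n}"
proof -
  have "delete_point (Suc n) p permutes {1..Suc n}"
    unfolding delete_point_eq_transpose[OF permutes_inj[OF assms]]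
    by (intro permutes_compose assms permutes_swap_id)
      (simp_all only: permutes_in_image[OF assms], simp_all)
  moreover have "delete_point (Suc n) p (Suc n) = Suc n" by (simp add: delete_point_def)
  ultimately show ?thesis
    by (elim permutes_superset) (auto simp: le_Suc_eq)
qed

text \<open>A transposition on the right puts \<open>m\<close> back into its cycle just after
  \<open>c\<close>. Hence deletion loses only the predecessor of \<open>m\<close>.\<close>

lemma insert_point:
  assumes "inj p" "p c = m"
  shows "p = delete_point m p \<circ> transpose c m"
proof
  fix x show "p x = (delete_point m p \<circ> transpose c m) x"
    using assms(2) inj_eq[OF assms(1), of x c]
    by (simp add: delete_point_def transpose_def)
qed

lemma delete_point_insert:
  assumes "q permutes {1..n}" "c \<in> {1..n}"
  shows "delete_point (Suc n) (q \<circ> transpose c (Suc n)) = q"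
proof -
  have "q (Suc n) = Suc n" using assms(1) by (simp add: permutes_def)
  moreover have "q x \<noteq> Suc n" if "x \<noteq> Suc n" for x
    using calculation that permutes_inj[OF assms(1)] by (metis injD)
  ultimately show ?thesis using assms(2) by (auto simp: delete_point_def transpose_def fun_eq_iff)
qed

lemma delete_point_conjugate:
  assumes "bij \<phi>" "\<phi> m = m"
  shows "delete_point m (inv' \<phi> \<circ> p \<circ> \<phi>) = inv' \<phi> \<circ> delete_point m p \<circ> \<phi>"
proof -
  have *: "inv' \<phi> m = m" "\<And>x. inv' \<phi> x = m \<longleftrightarrow> x = m" "\<And>x. \<phi> x = m \<longleftrightarrow> x = m"
    using assms by (metis bij_inv_eq_iff)+
  show ?thesis by (auto simp: fun_eq_iff delete_point_def * assms(2))
qed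

lemma orbit_delete_point:
  assumes "p m \<noteq> m" "x \<noteq> m"
  shows "orbit (delete_point m p) x = orbit p x - {m}"
proof (intro equalityI subsetI)
  let ?q = "delete_point m p"
  have q: "?q z = (if p z = m then p m else p z)" if "z \<noteq> m" for z
    using that by (simp add: delete_point_def)
  {
    fix y assume "y \<in> orbit ?q x"
    then show "y \<in> orbit p x - {m}"
    proof induction
      case base
      show ?case using assms orbit.base[of p x] orbit.step[of m p x] by (auto simp: q)
    next
      case (step y)
      then show ?case using assms orbit.step[of y p x] orbit.step[of m p x] by (auto simp: q)
    qed
  next
    fix y assume "y \<in> orbit p x - {m}"
    \<comment> \<open>Where the orbit of \<open>p\<close> passes through \<open>m\<close>, the
      deleted permutation jumps directly to \<open>p m\<close>. The second conjunct records that
      jump, so that the induction survives the visit to \<open>m\<close>.\<close>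
    moreover have "(y \<noteq> m \<longrightarrow> y \<in> orbit ?q x) \<and> (y = m \<longrightarrow> p m \<in> orbit ?q x)"
      if "y \<in> orbit p x" for y
      using that
    proof induction
      case base
      show ?case using orbit.base[of ?q x] assms by (simp add: q split: if_splits)
    next
      case (step y)
      then show ?case using orbit.step[of y ?q x] assms
        by (cases "y = m") (simp_all add: q split: if_splits)
    qed
    ultimately show "y \<in> orbit ?q x" by blast
  }
qed

text \<open>The cycle of \<open>Suc n\<close> has another point, so it is still met by
  \<open>{1..n}\<close>. Every cycle meeting \<open>{1..n}\<close> keeps such a point, so distinct
  cycles stay distinct when \<open>Suc n\<close> is removed.\<close>

lemma num_cycles_delete_point:
  assumes "p permutes {1..Suc n}" "p (Suc n) \<noteq> Suc n"
  shows "num_cycles n (delete_point (Suc n) p) = num_cycles (Suc n) p"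
proof -
  let ?N = "Suc n"
  have perm: "permutation p" using assms(1) permutation_permutes by blast
  have "p ?N \<in> {1..n}" using assms permutes_in_image[OF assms(1), of ?N] by auto
  moreover have "orbit p ?N = orbit p (p ?N)" using permutation_orbit_step[OF perm] by simp
  ultimately have "orbit p ` {1..n} = orbit p ` {1..?N}"
    by (auto simp: atLeastAtMostSuc_conv)
  moreover have "orbit (delete_point ?N p) ` {1..n} = (\<lambda>A. A - {?N}) ` orbit p ` {1..n}"
    unfolding image_image using assms(2) by (intro image_cong) (auto simp: orbit_delete_point)
  moreover have "inj_on (\<lambda>A. A - {?N}) (orbit p ` {1..n})"
  proof (rule inj_onI, clarify)
    fix x y assume xy: "x \<in> {1..n}" "y \<in> {1..n}" "orbit p x - {?N} = orbit p y - {?N}"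
    have "x \<in> orbit p x - {?N}"
      using permutation_self_in_orbit[OF perm, of x] xy(1) by simp
    then have "x \<in> orbit p y" unfolding xy(3) by blast
    then show "orbit p x = orbit p y"
      using perm by (simp add: cyclic_on_orbit' orbit_cyclic_eq3)
  qed
  ultimately show ?thesis by (simp add: num_cycles_def card_image)
qed

section \<open>Blocks between left-to-right maxima\<close>

lemma obtain_arg_max:
  fixes f :: "'a \<Rightarrow> nat"
  assumes "finite A" "A \<noteq> {}"
  obtains u where "u \<in> A" "\<And>y. y \<in> A \<Longrightarrow> f y \<le> f u"
  using assms by (metis Max_ge finite_imageI imageI obtains_MAX)

section \<open>The product of the cycles of consecutive intervals\<close>

text \<open>\<open>cycle_of_list\<close> splits off a transposition at the front of the list; both
  values follow by induction on the length of the interval.\<close>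

lemma cycle_of_list_upt:
  shows "a \<le> x \<Longrightarrow> Suc x < b \<Longrightarrow> cycle_of_list [a..<b] x = Suc x"
    and "a < b \<Longrightarrow> cycle_of_list [a..<b] (b - 1) = a"
proof (induction "b - a" arbitrary: a x)
  case (Suc k)
  {
    case 1
    then have "[a..<b] = a # Suc a # [Suc (Suc a)..<b]" by (simp add: upt_rec)
    moreover have "[Suc a..<b] = Suc a # [Suc (Suc a)..<b]" using 1 by (simp add: upt_rec)
    ultimately have "cycle_of_list [a..<b] = transpose a (Suc a) \<circ> cycle_of_list [Suc a..<b]"
      by simp
    moreover have "cycle_of_list [Suc a..<b] x = (if x = a then a else Suc x)"
      using Suc.hyps 1 by (auto intro: id_outside_supp)
    ultimately show ?case using 1 by (auto simp: transpose_def)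
  next
    case 2
    show ?case
    proof (cases "Suc a = b")
      case True
      then show ?thesis by auto
    next
      case False
      with 2 have "[a..<b] = a # Suc a # [Suc (Suc a)..<b]" by (simp add: upt_rec)
      moreover have "[Suc a..<b] = Suc a # [Suc (Suc a)..<b]" using 2 False by (simp add: upt_rec)
      ultimately have "cycle_of_list [a..<b] = transpose a (Suc a) \<circ> cycle_of_list [Suc a..<b]"
        by simp
      moreover have "cycle_of_list [Suc a..<b] (b - 1) = Suc a"
        using Suc.hyps(2)[of "Suc a"] Suc.hyps(3) 2 False by simp
      ultimately show ?thesis by simp
    qed
  }
qed auto

text \<open>The fold in \<open>omr_cycles\<close> as a recursion on the list of block starts. The
  number \<open>e\<close> is one past the last block, so \<open>hd (is @ [e])\<close> is always the
  end of the first one.\<close>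

fun interval_cycles :: "nat list \<Rightarrow> nat \<Rightarrow> nat \<Rightarrow> nat" where
  "interval_cycles [] e = id"
| "interval_cycles (a # is) e = cycle_of_list [a..<hd (is @ [e])] \<circ> interval_cycles is e"

lemma omr_cycles_eq_interval_cycles:
  "omr_cycles m \<theta> = interval_cycles (sorted_list_of_set (lr_max_indices m \<theta>)) (Suc m)"
proof -
  have "foldr (\<lambda>(i, j) p. cycle_of_list [i..<j] \<circ> p) (zip is (tl is @ [e])) id
    = interval_cycles is e" for "is" e
  proof (induction "is")
    case (Cons a "is")
    then show ?case by (cases "is") auto
  qed simp
  then show ?thesis by (simp add: omr_cycles_def)
qed

lemma interval_cycles_below:
  "sorted_wrt (<) (is @ [e]) \<Longrightarrow> x < hd (is @ [e]) \<Longrightarrow> interval_cycles is e x = x"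
proof (induction "is")
  case (Cons a "is")
  have "x < hd (is @ [e])" using Cons.prems by (cases "is") auto
  then have "interval_cycles is e x = x" using Cons by simp
  then show ?case using Cons.prems by (simp add: id_outside_supp)
qed simp

lemma interval_cycles_permutes:
  "sorted_wrt (<) (is @ [e]) \<Longrightarrow> interval_cycles is e permutes {hd (is @ [e])..<e}"
proof (induction "is")
  case (Cons a "is")
  let ?h = "hd (is @ [e])"
  have h: "a < ?h" "?h \<le> e" using Cons.prems by (cases "is"; auto)+
  have "cycle_of_list [a..<?h] permutes {a..<e}"
    by (rule permutes_subset[OF cycle_permutes]) (use h in auto)
  moreover have "interval_cycles is e permutes {a..<e}"
    by (rule permutes_subset[OF Cons.IH]) (use Cons.prems h in auto)
  ultimately show ?case
    by (simp only: interval_cycles.simps list.sel append_Cons permutes_compose)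
qed simp

text \<open>Here \<open>u\<close> and \<open>i\<close> are neighbours in \<open>is @ [e]\<close>.
  Cycles of later blocks fix all points below \<open>i\<close>, cycles of earlier blocks fix all
  points from \<open>u\<close> on, so a single factor acts on \<open>{u..<i}\<close>.\<close>

lemma interval_cycles_block:
  assumes "sorted_wrt (<) (is @ [e])" "i \<in> set (is @ [e])" "u \<in> set is" "u < i"
    "\<forall>s\<in>set is. s < i \<longrightarrow> s \<le> u"
  shows "(\<forall>x\<ge>u. Suc x < i \<longrightarrow> interval_cycles is e x = Suc x) \<and> interval_cycles is e (i - 1) = u"
  using assms
proof (induction "is")
  case (Cons a "is")
  let ?h = "hd (is @ [e])"
  have h: "a < ?h" "?h \<le> x" if "x \<in> set (is @ [e])" for x
    using Cons.prems(1) that by (cases "is"; auto)+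
  have sorted: "sorted_wrt (<) (is @ [e])" using Cons.prems(1) by simp
  have i: "i \<in> set (is @ [e])" using Cons.prems by auto
  show ?case
  proof (cases "u = a")
    case True
    \<comment> \<open>Otherwise the second block start would lie strictly between \<open>u\<close>
      and \<open>i\<close>.\<close>
    have "i = ?h"
    proof (rule ccontr)
      assume "i \<noteq> ?h"
      then have "?h < i" using h(2)[OF i] by simp
      moreover have "is \<noteq> []" using calculation i by auto
      ultimately show False using Cons.prems(5) True h(1)[OF i] by (cases "is") auto
    qed
    then show ?thesis
      using True Cons.prems(4) cycle_of_list_upt interval_cycles_below[OF sorted] by auto
  next
    case False
    then have u: "u \<in> set is" using Cons.prems by auto
    have "cycle_of_list [a..<?h] x = x" if "x \<ge> u" for x
      using that h(2)[of u] u by (intro id_outside_supp) auto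
    then show ?thesis using Cons.IH[OF sorted i u] Cons.prems by auto
  qed
qed simp

text \<open>Traversal of a labelled pair downwards from \<open>m + 1\<close>: once \<open>{i..m}\<close> is explored, the next
  block \<open>{u..<i}\<close> is the \<open>\<sigma>\<close>-cycle of the point \<open>u < i\<close> whose image under \<open>\<theta>\<close> is the largest
  explored label hit from outside. At the start \<open>i = m + 1\<close> nothing is explored, and the \<open>min\<close>
  forces \<open>\<theta> u = m\<close>. The labelling is canonical if the traversal reaches \<open>1\<close>.\<close>

definition block_step ::
    "nat \<Rightarrow> (nat \<Rightarrow> nat) \<Rightarrow> (nat \<Rightarrow> nat) \<Rightarrow> nat \<Rightarrow> nat \<Rightarrow> bool" where
  "block_step m \<sigma> \<theta> i u \<longleftrightarrow> 1 \<le> u \<and> u < i \<and> i \<le> Suc m \<and>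
     (\<forall>x\<ge>u. Suc x < i \<longrightarrow> \<sigma> x = Suc x) \<and> \<sigma> (i - 1) = u \<and>
     (\<forall>x\<in>{1..<i}. \<theta> x \<le> \<theta> u) \<and> min i m \<le> \<theta> u"

section \<open>Left-to-right maxima as the stops of the traversal\<close>

lemma lr_max_indices_subset: "lr_max_indices m \<theta> \<subseteq> {1..m}"
  by (auto simp: lr_max_indices_def)

lemma finite_lr_max_indices [simp]: "finite (lr_max_indices m \<theta>)"
  using lr_max_indices_subset finite_subset by blast

lemma one_in_lr_max_indices: "1 \<le> m \<Longrightarrow> 1 \<in> lr_max_indices m \<theta>"
  by (auto simp: lr_max_indices_def)

lemma sorted_lr_max_indices:
  "sorted_wrt (<) (sorted_list_of_set (lr_max_indices m \<theta>) @ [Suc m])"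
  using lr_max_indices_subset[of m \<theta>] by (auto simp: sorted_wrt_append)

lemma omr_cycles_permutes:
  assumes "1 \<le> m"
  shows "omr_cycles m \<theta> permutes {1..m}"
proof -
  let ?is = "sorted_list_of_set (lr_max_indices m \<theta>)"
  have "1 \<le> hd (?is @ [Suc m])"
    using lr_max_indices_subset[of m \<theta>] hd_in_set[of ?is] by (cases "?is = []") auto
  then show ?thesis
    unfolding omr_cycles_eq_interval_cycles
    by (intro permutes_subset[OF interval_cycles_permutes[OF sorted_lr_max_indices]]) auto
qed

text \<open>The start of the block that ends just below \<open>i\<close>. For
  \<open>m \<ge> 1\<close> and \<open>i > 1\<close> the set contains 1, so the maximum is
  meaningful.\<close>

definition prev_lr_max :: "nat \<Rightarrow> (nat \<Rightarrow> nat) \<Rightarrow> nat \<Rightarrow> nat" where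
  "prev_lr_max m \<theta> i = Max {s \<in> lr_max_indices m \<theta>. s < i}"

lemma prev_lr_max:
  assumes "1 \<le> m" "1 < i"
  shows "prev_lr_max m \<theta> i \<in> lr_max_indices m \<theta>" "prev_lr_max m \<theta> i < i"
    and "\<And>s. s \<in> lr_max_indices m \<theta> \<Longrightarrow> s < i \<Longrightarrow> s \<le> prev_lr_max m \<theta> i"
proof -
  let ?S = "{s \<in> lr_max_indices m \<theta>. s < i}"
  have "finite ?S" "?S \<noteq> {}" using one_in_lr_max_indices[OF assms(1)] assms(2) by auto
  then show "prev_lr_max m \<theta> i \<in> lr_max_indices m \<theta>" "prev_lr_max m \<theta> i < i"
    "\<And>s. s \<in> lr_max_indices m \<theta> \<Longrightarrow> s < i \<Longrightarrow> s \<le> prev_lr_max m \<theta> i"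
    using Max_in[of ?S] by (auto simp: prev_lr_max_def)
qed

lemma omr_cycles_block:
  assumes "1 < i" "i \<in> insert (Suc m) (lr_max_indices m \<theta>)"
  shows "prev_lr_max m \<theta> i \<le> x \<Longrightarrow> Suc x < i \<Longrightarrow> omr_cycles m \<theta> x = Suc x"
    and "omr_cycles m \<theta> (i - 1) = prev_lr_max m \<theta> i"
proof -
  have "1 \<le> m" using assms lr_max_indices_subset[of m \<theta>] by fastforce
  then show "prev_lr_max m \<theta> i \<le> x \<Longrightarrow> Suc x < i \<Longrightarrow> omr_cycles m \<theta> x = Suc x"
    and "omr_cycles m \<theta> (i - 1) = prev_lr_max m \<theta> i"
    using interval_cycles_block[OF sorted_lr_max_indices, of i m \<theta> "prev_lr_max m \<theta> i"] assms
      prev_lr_max[where m = m and i = i and \<theta> = \<theta>]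
    by (auto simp: omr_cycles_eq_interval_cycles)
qed

text \<open>By injectivity the point of \<open>{1..<i}\<close> with the largest image is itself a
  left-to-right maximum, and images increase along left-to-right maxima. So the last one before
  \<open>i\<close> carries the largest image.\<close>

lemma le_prev_lr_max:
  assumes "\<theta> permutes {1..m}" "1 < i" "i \<le> Suc m" "x \<in> {1..<i}"
  shows "\<theta> x \<le> \<theta> (prev_lr_max m \<theta> i)"
proof -
  have m: "1 \<le> m" using assms by auto
  obtain u where u: "u \<in> {1..<i}" "\<And>y. y \<in> {1..<i} \<Longrightarrow> \<theta> y \<le> \<theta> u"
    using obtain_arg_max[of "{1..<i}" \<theta>] assms(2) by auto
  have "\<theta> j < \<theta> u" if "j \<in> {1..<u}" for j
    using u that inj_eq[OF permutes_inj[OF assms(1)], of j u] by (fastforce simp: le_less)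
  then have "u \<in> lr_max_indices m \<theta>" using u(1) assms by (auto simp: lr_max_indices_def)
  then have "u \<le> prev_lr_max m \<theta> i" using u(1) prev_lr_max(3)[OF m assms(2)] by auto
  then have "\<theta> u \<le> \<theta> (prev_lr_max m \<theta> i)"
    using prev_lr_max(1,2)[OF m assms(2), of \<theta>] u(1)
    by (cases "u = prev_lr_max m \<theta> i") (auto simp: lr_max_indices_def less_imp_le)
  then show ?thesis using u(2)[OF assms(4)] by simp
qed

text \<open>The block shape and the maximality hold for the block cycles of any permutation.
  Indecomposability enters only in the lower bound \<open>min i m\<close> on the image.\<close>

lemma block_step_omr_cycles:
  assumes "\<theta> permutes {1..m}" "\<not> decomposable m \<theta>" "1 < i"
    "i \<in> insert (Suc m) (lr_max_indices m \<theta>)"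
  shows "block_step m (omr_cycles m \<theta>) \<theta> i (prev_lr_max m \<theta> i)"
proof -
  let ?u = "prev_lr_max m \<theta> i"
  have i: "i \<le> Suc m" using assms(4) lr_max_indices_subset[of m \<theta>] by auto
  then have m: "1 \<le> m" using assms(3) by simp
  note le = le_prev_lr_max[OF assms(1,3) i]
  have "min i m \<le> \<theta> ?u"
  proof (rule ccontr)
    assume less: "\<not> min i m \<le> \<theta> ?u"
    show False
    proof (cases "i = Suc m")
      case True
      obtain x where "x \<in> {1..m}" "\<theta> x = m"
        using permutes_image[OF assms(1)] m by (metis atLeastAtMost_iff imageE order_refl)
      then show ?thesis using le[of x] less True by auto
    next
      case False
      \<comment> \<open>If all images on \<open>{1..<i}\<close> stay below \<open>i\<close>, then
        \<open>p = i - 1\<close> decomposes \<theta>.\<close>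
      then have "i - 1 \<in> {1..<m}" using assms(3) i by auto
      moreover have "1 \<le> \<theta> x \<and> \<theta> x \<le> i - 1" if "x \<in> {1..i - 1}" for x
        using le[of x] that less False i permutes_in_image[OF assms(1), of x]
        by (simp add: min_def split: if_splits; linarith)
      ultimately show ?thesis using assms(2) unfolding decomposable_def by blast
    qed
  qed
  then show ?thesis
    using omr_cycles_block[OF assms(3,4)] le i prev_lr_max[OF m assms(3), where \<theta> = \<theta>]
      lr_max_indices_subset[of m \<theta>]
    by (auto simp: block_step_def)
qed

lemma block_steps_omr_cycles:
  assumes "\<theta> permutes {1..m}" "\<not> decomposable m \<theta>" "1 \<le> m"
  shows "(block_step m (omr_cycles m \<theta>) \<theta>)\<^sup>*\<^sup>* (Suc m) 1"
proof -
  have "(block_step m (omr_cycles m \<theta>) \<theta>)\<^sup>*\<^sup>* i 1"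
    if "i \<in> insert (Suc m) (lr_max_indices m \<theta>)" for i
    using that
  proof (induction i rule: less_induct)
    case (less i)
    show ?case
    proof (cases "1 < i")
      case True
      then show ?thesis
        using block_step_omr_cycles[OF assms(1,2) True less.prems] less.IH
          prev_lr_max(1,2)[OF assms(3) True, of \<theta>]
        by (meson converse_rtranclp_into_rtranclp insertI2)
    next
      case False
      then have "i = 1" using less.prems lr_max_indices_subset[of m \<theta>] assms(3) by auto
      then show ?thesis by simp
    qed
  qed
  then show ?thesis by blast
qed

text \<open>An invariant prefix \<open>{1..p}\<close> with \<open>p < m\<close> can never be
  entered: a step from \<open>i > p\<close> to \<open>u \<le> p\<close> would need an image
  \<open>\<theta> u \<ge> min i m > p\<close>.\<close>

lemma block_steps_indecomposable:
  assumes "(block_step m \<sigma> \<theta>)\<^sup>*\<^sup>* (Suc m) 1"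
  shows "\<not> decomposable m \<theta>"
proof
  assume "decomposable m \<theta>"
  then obtain p where p: "p \<in> {1..<m}" "\<And>i. i \<in> {1..p} \<Longrightarrow> \<theta> i \<le> p"
    unfolding decomposable_def by blast
  have "p < i" if "(block_step m \<sigma> \<theta>)\<^sup>*\<^sup>* (Suc m) i" for i
    using that
  proof induction
    case base
    then show ?case using p by simp
  next
    case (step i u)
    then show ?case using p(1) p(2)[of u] by (fastforce simp: block_step_def)
  qed
  then show False using assms p(1) by fastforce
qed

text \<open>The next stop is the unique maximiser of \<theta> on \<open>{1..<i}\<close>, so a
  complete traversal for any \<sigma> stops exactly where the one for
  \<open>omr_cycles m \<theta>\<close> does, and the block shape then determines \<sigma>.\<close>

lemma block_steps_imp_omr_cycles:
  assumes "\<sigma> permutes {1..m}" "\<theta> permutes {1..m}" "1 \<le> m"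
    "(block_step m \<sigma> \<theta>)\<^sup>*\<^sup>* (Suc m) 1"
  shows "\<sigma> = omr_cycles m \<theta>"
proof
  fix x
  note omr = block_step_omr_cycles[OF assms(2) block_steps_indecomposable[OF assms(4)]]
  have agree: "i \<in> insert (Suc m) (lr_max_indices m \<theta>) \<and> (\<forall>x\<in>{i..m}. \<sigma> x = omr_cycles m \<theta> x)"
    if "(block_step m \<sigma> \<theta>)\<^sup>*\<^sup>* (Suc m) i" for i
    using that
  proof induction
    case (step i u)
    let ?v = "prev_lr_max m \<theta> i"
    have u: "block_step m \<sigma> \<theta> i u" by fact
    then have "1 < i" by (simp add: block_step_def)
    with step.IH have v: "block_step m (omr_cycles m \<theta>) \<theta> i ?v" by (intro omr) auto
    \<comment> \<open>Both points maximise \<theta> on \<open>{1..<i}\<close>.\<close>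
    have "\<theta> u = \<theta> ?v"
      using u v by (intro antisym) (auto simp: block_step_def)
    then have "u = ?v" using permutes_inj[OF assms(2)] by (simp add: inj_eq)
    then have u': "block_step m (omr_cycles m \<theta>) \<theta> i u" using v by simp
    have "\<sigma> x = omr_cycles m \<theta> x" if "x \<in> {u..m}" for x
    proof (cases "x < i")
      case True
      then consider "Suc x < i" | "x = i - 1" by linarith
      then show ?thesis using u u' that by cases (auto simp: block_step_def)
    next
      case False
      then show ?thesis using step.IH that by simp
    qed
    then show ?case
      using prev_lr_max(1)[OF assms(3) \<open>1 < i\<close>] \<open>u = ?v\<close> by auto
  qed auto
  show "\<sigma> x = omr_cycles m \<theta> x"
  proof (cases "x \<in> {1..m}")
    case True
    then show ?thesis using agree[OF assms(4)] by blast
  next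
    case False
    then show ?thesis
      using permutes_not_in[OF assms(1)] permutes_not_in[OF omr_cycles_permutes[OF assms(3)]] by metis
  qed
qed

section \<open>Rigidity and existence of canonical labellings\<close>

text \<open>Every explored point lies on the same side of an invariant set as \<open>m\<close>: a
  new block start is linked by \<theta> to an explored point or to \<open>m\<close>, and \<sigma>
  links the rest of its block.\<close>

lemma block_steps_connected:
  assumes "\<sigma> permutes {1..m}" "\<theta> permutes {1..m}" "1 \<le> m"
    "(block_step m \<sigma> \<theta>)\<^sup>*\<^sup>* (Suc m) 1"
  shows "connected_on {1..m} \<sigma> \<theta>"
  unfolding connected_on_def
proof (intro allI impI)
  fix A assume A: "A \<subseteq> {1..m}" "A \<noteq> {}" "\<sigma> ` A \<subseteq> A" "\<theta> ` A \<subseteq> A"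
  have fin: "finite A" using A(1) finite_subset by blast
  note \<sigma>A = permutes_invariant_iff[OF assms(1) fin A(3)]
  note \<theta>A = permutes_invariant_iff[OF assms(2) fin A(4)]
  have "\<forall>x\<in>{i..m}. x \<in> A \<longleftrightarrow> m \<in> A" if "(block_step m \<sigma> \<theta>)\<^sup>*\<^sup>* (Suc m) i" for i
    using that
  proof induction
    case (step i u)
    then have u: "1 \<le> u" "u < i" "i \<le> Suc m" "\<And>x. u \<le> x \<Longrightarrow> Suc x < i \<Longrightarrow> \<sigma> x = Suc x"
      "min i m \<le> \<theta> u"
      by (auto simp: block_step_def)
    have "\<theta> u \<le> m" using permutes_in_image[OF assms(2), of u] u by auto
    \<comment> \<open>At \<open>i = Suc m\<close> nothing is explored yet, and the link goes to
      \<open>m\<close> itself.\<close>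
    then have "\<theta> u \<in> {i..m} \<or> \<theta> u = m" using u(3,5) by (auto simp: min_def split: if_splits)
    then have "\<theta> u \<in> A \<longleftrightarrow> m \<in> A" using step.IH by blast
    then have uA: "u \<in> A \<longleftrightarrow> m \<in> A" using \<theta>A by simp
    have "u + j \<in> A \<longleftrightarrow> m \<in> A" if "u + j < i" for j
      using that
    proof (induction j)
      case (Suc j)
      then show ?case using u(4)[of "u + j"] \<sigma>A[of "u + j"] by simp
    qed (use uA in simp)
    then have "x \<in> A \<longleftrightarrow> m \<in> A" if "u \<le> x" "x < i" for x
      using that le_add_diff_inverse by metis
    then show ?case using step.IH by (metis atLeastAtMost_iff not_less)
  qed simp
  then have "\<forall>x\<in>{1..m}. x \<in> A \<longleftrightarrow> m \<in> A" using assms(4) by blast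
  then show "A = {1..m}" using A(1,2) by blast
qed

text \<open>The two traversals run in lockstep. While \<open>\<phi>\<close> fixes the explored
  labels, it must carry the next block start to the next block start, then the whole block along
  \<sigma>, and equal block lengths make it fix that block too.\<close>

lemma block_steps_rigid:
  assumes \<theta>: "\<theta> permutes {1..m}" and m: "1 \<le> m" and \<phi>: "\<phi> permutes {1..m}" "\<phi> m = m"
    and conj: "\<And>x. \<sigma> (\<phi> x) = \<phi> (\<sigma>' x)" "\<And>x. \<theta> (\<phi> x) = \<phi> (\<theta>' x)"
    and steps: "(block_step m \<sigma> \<theta>)\<^sup>*\<^sup>* (Suc m) 1" "(block_step m \<sigma>' \<theta>')\<^sup>*\<^sup>* (Suc m) 1"
  shows "\<phi> = id"
proof -
  have inj: "\<phi> x = \<phi> y \<longleftrightarrow> x = y" for x y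
    using permutes_inj[OF \<phi>(1)] by (auto dest: injD)
  have "(block_step m \<sigma>' \<theta>')\<^sup>*\<^sup>* i 1 \<Longrightarrow> \<forall>x\<ge>i. \<phi> x = x \<Longrightarrow> \<forall>x\<ge>1. \<phi> x = x"
    if "(block_step m \<sigma> \<theta>)\<^sup>*\<^sup>* i 1" for i
    using that
  proof (induction rule: converse_rtranclp_induct)
    case (step i u)
    then have u: "1 \<le> u" "u < i" "i \<le> Suc m" "\<And>x. u \<le> x \<Longrightarrow> Suc x < i \<Longrightarrow> \<sigma> x = Suc x"
      "\<sigma> (i - 1) = u" "\<And>x. x \<in> {1..<i} \<Longrightarrow> \<theta> x \<le> \<theta> u" "min i m \<le> \<theta> u"
      by (auto simp: block_step_def)
    obtain u' where u'_step: "block_step m \<sigma>' \<theta>' i u'" "(block_step m \<sigma>' \<theta>')\<^sup>*\<^sup>* u' 1"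
      using step.prems(1) u by (metis converse_rtranclpE not_less)
    then have u': "1 \<le> u'" "u' < i" "\<And>x. u' \<le> x \<Longrightarrow> Suc x < i \<Longrightarrow> \<sigma>' x = Suc x"
      "\<sigma>' (i - 1) = u'" "\<And>x. x \<in> {1..<i} \<Longrightarrow> \<theta>' x \<le> \<theta>' u'" "min i m \<le> \<theta>' u'"
      by (auto simp: block_step_def)
    have fixed: "\<phi> x = x" if "i \<le> x" for x using step.prems(2) that by simp
    have below: "\<phi> x < i \<longleftrightarrow> x < i" for x
      using fixed[of x] fixed[of "\<phi> x"] inj[of "\<phi> x" x] by (metis not_less)
    have pos: "1 \<le> \<phi> x \<longleftrightarrow> 1 \<le> x" for x
      using permutes_not_in[OF \<phi>(1), of 0] inj[of x 0] by (auto simp: Suc_le_eq)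
    \<comment> \<open>In the first step both starts are the images of \<open>m\<close> under
      \<sigma> and \<open>\<sigma>'\<close>. Later, the maximal images are at least
      \<open>i\<close>, hence fixed by \<open>\<phi>\<close>, and each bounds the other.\<close>
    have "\<phi> u' = u"
    proof (cases "i = Suc m")
      case True
      then show ?thesis using u(5) u'(4) conj(1)[of m] \<phi>(2) by simp
    next
      case False
      then have i: "i \<le> m" using u(3) by simp
      have "\<theta> (\<phi> u') = \<theta>' u'" using conj(2) fixed u'(6) i by simp
      moreover have "\<theta> (\<phi> u') \<le> \<theta> u"
        using u(6) below[of u'] pos[of u'] u'(1,2) by simp
      moreover have "\<theta> u \<le> \<theta>' u'"
      proof -
        obtain y where y: "\<phi> y = u" using permutes_surj[OF \<phi>(1)] by (metis surjD)
        have "\<phi> (\<theta>' y) = \<phi> (\<theta> u)" using conj(2)[of y] y fixed[of "\<theta> u"] u(7) i by simp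
        then have "\<theta>' y = \<theta> u" using inj by simp
        moreover have "y \<in> {1..<i}" using below[of y] pos[of y] y u(1,2) by simp
        ultimately show ?thesis using u'(5) by fastforce
      qed
      ultimately have "\<theta> (\<phi> u') = \<theta> u" by simp
      then show ?thesis using permutes_inj[OF \<theta>] by (simp add: inj_eq)
    qed
    have shift: "\<phi> (u' + j) = u + j" if "u + j < i" "u' + j < i" for j
      using that
    proof (induction j)
      case (Suc j)
      then show ?case using conj(1)[of "u' + j"] u(4)[of "u + j"] u'(3)[of "u' + j"] by simp
    qed (use \<open>\<phi> u' = u\<close> in simp)
    have "u' = u"
    proof (rule ccontr)
      assume "u' \<noteq> u"
      then consider "u' < u" | "u < u'" by linarith
      then show False
      proof cases
        case 1
        \<comment> \<open>The \<sigma>-cycle closes at \<open>i - 1\<close> before the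
          \<open>\<sigma>'\<close>-cycle does, which would give \<open>Suc (u' + ?j) = u'\<close>.
          The other case is symmetric.\<close>
        let ?j = "i - 1 - u"
        have "\<phi> (u' + ?j) = i - 1" using shift[of ?j] u(2) 1 by simp
        then have "\<phi> (Suc (u' + ?j)) = \<phi> u'"
          using conj(1)[of "u' + ?j"] u'(3)[of "u' + ?j"] u(2,5) 1 \<open>\<phi> u' = u\<close> by simp
        then show False using inj by simp
      next
        case 2
        let ?j = "i - 1 - u'"
        have "\<phi> (i - 1) = u + ?j" using shift[of ?j] u'(2) 2 by simp
        then have "\<phi> u' = Suc (u + ?j)"
          using conj(1)[of "i - 1"] u(4)[of "u + ?j"] u'(2,4) 2 by simp
        then show False using \<open>\<phi> u' = u\<close> by simp
      qed
    qed
    have "\<phi> x = x" if "u \<le> x" for x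
      using shift[of "x - u"] fixed[of x] that \<open>u' = u\<close> by (cases "x < i") auto
    then show ?case using step.IH u'_step(2) \<open>u' = u\<close> by blast
  qed simp
  moreover have "\<phi> x = x" if "x \<ge> Suc m" for x
    using permutes_not_in[OF \<phi>(1), of x] that by auto
  ultimately have "\<forall>x\<ge>1. \<phi> x = x" using steps by blast
  moreover have "\<phi> 0 = 0" using permutes_not_in[OF \<phi>(1), of 0] by simp
  ultimately have "\<phi> x = x" for x by (cases x) auto
  then show ?thesis by auto
qed

section \<open>Existence: relabelling along the traversal\<close>

lemma block_steps_closed:
  assumes "(block_step m \<sigma> \<theta>)\<^sup>*\<^sup>* (Suc m) i"
  shows "i \<le> Suc m \<and> \<sigma> ` {i..m} \<subseteq> {i..m}"
  using assms
proof induction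
  case (step i u)
  then have u: "u < i" "i \<le> Suc m" "\<And>x. u \<le> x \<Longrightarrow> Suc x < i \<Longrightarrow> \<sigma> x = Suc x" "\<sigma> (i - 1) = u"
    by (auto simp: block_step_def)
  have "\<sigma> x \<in> {u..m}" if "x \<in> {u..m}" for x
  proof -
    consider "Suc x < i" | "x = i - 1" | "i \<le> x" by linarith
    then show ?thesis
    proof cases
      case 3
      then show ?thesis using step.IH that u(1) by fastforce
    qed (use u that in auto)
  qed
  then show ?case using u by auto
qed simp

text \<open>Steps already made down to \<open>k\<close> survive a relabelling of the unexplored
  points \<open>{1..<k}\<close>, because the values they test are at least \<open>k\<close> or lose
  against one that is.\<close>

lemma block_steps_conjugate:
  assumes \<theta>: "\<theta> permutes {1..m}" and \<psi>: "\<psi> permutes {1..<k}" "\<psi> m = m"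
    and conj: "\<And>x. \<sigma> (\<psi> x) = \<psi> (\<sigma>' x)" "\<And>x. \<theta> (\<psi> x) = \<psi> (\<theta>' x)"
    and steps: "(block_step m \<sigma> \<theta>)\<^sup>*\<^sup>* i k"
  shows "(block_step m \<sigma>' \<theta>')\<^sup>*\<^sup>* i k"
  using steps
proof (induction rule: converse_rtranclp_induct)
  case (step i u)
  have inj: "\<psi> x = \<psi> y \<longleftrightarrow> x = y" for x y
    using permutes_inj[OF \<psi>(1)] by (auto dest: injD)
  have fixed: "\<psi> x = x" if "k \<le> x" for x using permutes_not_in[OF \<psi>(1), of x] that by simp
  have below: "\<psi> x < k \<longleftrightarrow> x < k" for x
    using fixed[of x] fixed[of "\<psi> x"] inj[of "\<psi> x" x] by (metis not_less)
  have "k \<le> u" using step.hyps(2)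
    by (induction rule: converse_rtranclp_induct) (auto simp: block_step_def)
  have u: "1 \<le> u" "u < i" "i \<le> Suc m" "\<And>x. u \<le> x \<Longrightarrow> Suc x < i \<Longrightarrow> \<sigma> x = Suc x"
    "\<sigma> (i - 1) = u" "\<And>x. x \<in> {1..<i} \<Longrightarrow> \<theta> x \<le> \<theta> u" "min i m \<le> \<theta> u"
    using step.hyps(1) by (auto simp: block_step_def)
  have \<sigma>': "\<sigma>' x = \<sigma> x" if "k \<le> x" "k \<le> \<sigma> x" for x
    using conj(1)[of x] fixed that inj[of "\<sigma>' x" "\<sigma> x"] by simp
  have \<theta>': "\<theta>' u = \<theta> u"
    using conj(2)[of u] fixed[of u] fixed[of "\<theta> u"] \<open>k \<le> u\<close> u inj[of "\<theta>' u" "\<theta> u"] by simp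
  \<comment> \<open>An image below \<open>k\<close> cannot exceed
    \<open>\<theta> u \<ge> min i m \<ge> k\<close>; an image from \<open>k\<close> on is not
    affected by the relabelling.\<close>
  have "\<theta>' x \<le> \<theta> u" if x: "x \<in> {1..<i}" for x
  proof (cases "\<theta>' x < k")
    case True
    then show ?thesis using \<open>k \<le> u\<close> u by simp
  next
    case False
    then have "\<theta>' x = \<theta> (\<psi> x)" using conj(2) fixed by simp
    moreover have "\<psi> x \<in> {1..<i}"
      using x below[of x] \<open>k \<le> u\<close> u(2) fixed[of x] permutes_in_image[OF \<psi>(1), of x]
      by (cases "x < k") auto
    ultimately show ?thesis using u(6) by simp
  qed
  then have "block_step m \<sigma>' \<theta>' i u"
    using u \<sigma>' \<theta>' \<open>k \<le> u\<close> by (auto simp: block_step_def)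
  then show ?case using step.IH by (rule converse_rtranclp_into_rtranclp)
qed simp

lemma connected_on_conjugate:
  assumes "connected_on X \<sigma> \<theta>" "\<phi> permutes X"
    and conj: "\<And>x. \<sigma> (\<phi> x) = \<phi> (\<sigma>' x)" "\<And>x. \<theta> (\<phi> x) = \<phi> (\<theta>' x)"
  shows "connected_on X \<sigma>' \<theta>'"
  unfolding connected_on_def
proof (intro allI impI)
  fix A assume A: "A \<subseteq> X" "A \<noteq> {}" "\<sigma>' ` A \<subseteq> A" "\<theta>' ` A \<subseteq> A"
  have "\<phi> ` A \<subseteq> X" using A(1) permutes_image[OF assms(2)] by blast
  moreover have "\<sigma> ` \<phi> ` A \<subseteq> \<phi> ` A" "\<theta> ` \<phi> ` A \<subseteq> \<phi> ` A" using A(3,4) conj by auto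
  ultimately have "\<phi> ` A = X" using assms(1) A(2) unfolding connected_on_def by blast
  then have "\<phi> ` A = \<phi> ` X" using permutes_image[OF assms(2)] by simp
  then show "A = X" using permutes_inj[OF assms(2)] by (simp add: inj_image_eq_iff)
qed

lemma permutes_conjugate:
  assumes "p permutes S" "\<phi> permutes S"
  shows "inv' \<phi> \<circ> p \<circ> \<phi> permutes S"
  by (intro permutes_compose assms permutes_inv)

lemma conjugate_apply:
  assumes "\<phi> permutes S"
  shows "p (\<phi> x) = \<phi> ((inv' \<phi> \<circ> p \<circ> \<phi>) x)"
  using assms by (simp add: permutes_inverses)

lemma inj_on_extends_to_permutation:
  assumes "finite S" "T \<subseteq> S" "inj_on f T" "f ` T \<subseteq> S"
  obtains \<psi> where "\<psi> permutes S" "\<And>x. x \<in> T \<Longrightarrow> \<psi> x = f x"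
proof -
  have "card (S - T) = card (S - f ` T)"
    using assms by (simp add: card_Diff_subset finite_subset card_image)
  then obtain g where g: "bij_betw g (S - T) (S - f ` T)"
    using assms(1) finite_same_card_bij by blast
  define \<psi> where "\<psi> x = (if x \<in> T then f x else if x \<in> S then g x else x)" for x
  have "bij_betw \<psi> T (f ` T)"
    using assms(3) by (intro bij_betw_imageI) (auto simp: \<psi>_def inj_on_def)
  moreover have "bij_betw \<psi> (S - T) (S - f ` T)"
    using g by (rule bij_betw_cong[THEN iffD1, rotated]) (simp add: \<psi>_def)
  ultimately have "bij_betw \<psi> (T \<union> (S - T)) (f ` T \<union> (S - f ` T))"
    by (intro bij_betw_combine) auto
  then have "bij_betw \<psi> S S"
    using assms(2,4) by (simp add: Un_absorb1)
  then have "\<psi> permutes S"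
    using assms(2) by (intro bij_imp_permutes) (auto simp: \<psi>_def)
  then show ?thesis using that by (simp add: \<psi>_def)
qed

text \<open>The traversal cannot get stuck. The unexplored set \<open>{1..<i}\<close> is closed
  under \<sigma>, so when it is proper, connectivity forces \<theta> to leave it, which can only be
  into the explored labels. In the first step the root condition plays this part.\<close>

lemma block_steps_next_max:
  assumes \<theta>: "\<theta> permutes {1..m}" and m: "1 \<le> m" and \<sigma>: "\<sigma> permutes {1..m}"
    and root: "\<theta> (\<sigma> m) = m" and conn: "connected_on {1..m} \<sigma> \<theta>"
    and steps: "(block_step m \<sigma> \<theta>)\<^sup>*\<^sup>* (Suc m) i" and i: "1 < i"
  obtains w where "w \<in> {1..<i}" "\<forall>x\<in>{1..<i}. \<theta> x \<le> \<theta> w" "min i m \<le> \<theta> w"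
    "i = Suc m \<longrightarrow> w = \<sigma> m" "\<sigma> ` {1..<i} \<subseteq> {1..<i}"
proof -
  have im: "i \<le> Suc m" "\<sigma> ` {i..m} \<subseteq> {i..m}" using block_steps_closed[OF steps] by auto
  have closed: "\<sigma> ` {1..<i} \<subseteq> {1..<i}"
  proof
    fix y assume "y \<in> \<sigma> ` {1..<i}"
    then obtain x where x: "x \<in> {1..<i}" "y = \<sigma> x" by blast
    then have "y \<in> {1..m}" using permutes_in_image[OF \<sigma>, of x] im(1) by auto
    moreover have "y \<notin> {i..m}"
      using permutes_invariant_iff[OF \<sigma> _ im(2), of x] x by auto
    ultimately show "y \<in> {1..<i}" by auto
  qed
  obtain w where w: "w \<in> {1..<i}" "\<forall>x\<in>{1..<i}. \<theta> x \<le> \<theta> w"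
    using obtain_arg_max[of "{1..<i}" \<theta>] i by (metis atLeastLessThan_empty_iff finite_atLeastLessThan not_less)
  show ?thesis
  proof (cases "i = Suc m")
    case True
    have "\<sigma> m \<in> {1..m}" using permutes_in_image[OF \<sigma>, of m] m by simp
    then have "m \<le> \<theta> w" using w(2) root True \<open>\<sigma> m \<in> {1..m}\<close>
      by (metis atLeastLessThanSuc_atLeastAtMost)
    moreover have "\<theta> w \<le> m" using permutes_in_image[OF \<theta>, of w] w(1) True by auto
    ultimately have "\<theta> w = \<theta> (\<sigma> m)" using root by simp
    then have "w = \<sigma> m" using permutes_inj[OF \<theta>] by (simp add: inj_eq)
    then show ?thesis using that[OF w] closed \<open>m \<le> \<theta> w\<close> by simp
  next
    case False
    have "\<not> \<theta> ` {1..<i} \<subseteq> {1..<i}"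
    proof
      assume "\<theta> ` {1..<i} \<subseteq> {1..<i}"
      moreover have "{1..<i} \<subseteq> {1..m}" "{1..<i} \<noteq> {}" using im(1) i by auto
      moreover have "i \<in> {1..m} - {1..<i}" using im(1) i False by simp
      then have "{1..<i} \<noteq> {1..m}" by blast
      ultimately show False using conn closed unfolding connected_on_def by blast
    qed
    then obtain x where x: "x \<in> {1..<i}" "\<theta> x \<notin> {1..<i}" by blast
    then have "i \<le> \<theta> x" using permutes_in_image[OF \<theta>, of x] im(1) by auto
    then have "i \<le> \<theta> w" using w(2) x(1) by fastforce
    then show ?thesis using that[OF w] closed False by simp
  qed
qed

text \<open>The \<sigma>-cycle of the next start \<open>w\<close> is given the labels just below
  \<open>i\<close> in cyclic order, beginning with \<open>w\<close>. This changes unexplored labels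
  only, so the earlier steps persist and one more becomes possible.\<close>

lemma block_steps_extend:
  assumes \<theta>: "\<theta> permutes {1..m}" and m: "1 \<le> m" and \<sigma>: "\<sigma> permutes {1..m}"
    and root: "\<theta> (\<sigma> m) = m" and conn: "connected_on {1..m} \<sigma> \<theta>"
    and steps: "(block_step m \<sigma> \<theta>)\<^sup>*\<^sup>* (Suc m) i" and i: "1 < i"
  obtains \<psi> u where "\<psi> permutes {1..m}" "\<psi> m = m" "u < i"
    "(block_step m (inv' \<psi> \<circ> \<sigma> \<circ> \<psi>) (inv' \<psi> \<circ> \<theta> \<circ> \<psi>))\<^sup>*\<^sup>* (Suc m) u"
proof -
  obtain w where w: "w \<in> {1..<i}" "\<forall>x\<in>{1..<i}. \<theta> x \<le> \<theta> w" "min i m \<le> \<theta> w"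
    "i = Suc m \<longrightarrow> w = \<sigma> m" and closed: "\<sigma> ` {1..<i} \<subseteq> {1..<i}"
    using block_steps_next_max[OF assms] by blast
  have im: "i \<le> Suc m" using block_steps_closed[OF steps] by simp
  have perm: "permutation \<sigma>" using \<sigma> permutation_permutes by blast
  \<comment> \<open>The length of the cycle of \<open>w\<close>; its points are the distinct
    iterates with exponents below \<open>l\<close>.\<close>
  define l where "l = least_power \<sigma> w"
  have l: "0 < l" "(\<sigma> ^^ l) w = w"
    using least_power_of_permutation[OF perm] by (simp_all add: l_def)
  have distinct: "inj_on (\<lambda>j. (\<sigma> ^^ j) w) {0..<l}"
    using cycle_of_permutation[OF perm, of w] by (simp add: distinct_map l_def)
  have orb: "(\<sigma> ^^ j) w \<in> {1..<i}" for j
    by (induction j) (use w(1) closed[unfolded image_subset_iff] in auto)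
  have "card {0..<l} \<le> card {1..<i}"
    using orb by (intro card_inj_on_le[OF distinct]) auto
  then have "l < i" using i by simp
  define u where "u = i - l"
  have u: "1 \<le> u" "u < i" "u + l = i" using \<open>l < i\<close> l(1) by (auto simp: u_def)
  obtain \<psi> where \<psi>: "\<psi> permutes {1..<i}" "\<And>x. x \<in> {u..<i} \<Longrightarrow> \<psi> x = (\<sigma> ^^ (x - u)) w"
  proof (rule inj_on_extends_to_permutation[of "{1..<i}" "{u..<i}" "\<lambda>x. (\<sigma> ^^ (x - u)) w"])
    show "inj_on (\<lambda>x. (\<sigma> ^^ (x - u)) w) {u..<i}"
    proof (rule inj_onI)
      fix x y assume xy: "x \<in> {u..<i}" "y \<in> {u..<i}" "(\<sigma> ^^ (x - u)) w = (\<sigma> ^^ (y - u)) w"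
      then have "x - u = y - u" using inj_onD[OF distinct, of "x - u" "y - u"] u(3) by auto
      then show "x = y" using xy by auto
    qed
  qed (use u orb in auto)
  have \<psi>_shift: "\<psi> (u + j) = (\<sigma> ^^ j) w" if "j < l" for j
    using \<psi>(2)[of "u + j"] that u by simp
  have last: "\<sigma> (\<psi> (i - 1)) = w"
  proof -
    have "\<psi> (i - 1) = (\<sigma> ^^ (l - 1)) w" using \<psi>_shift[of "l - 1"] l(1) u(3) by simp
    then show ?thesis using l by (cases l) auto
  qed
  have inj: "\<psi> x = \<psi> y \<longleftrightarrow> x = y" for x y
    using permutes_inj[OF \<psi>(1)] by (auto dest: injD)
  \<comment> \<open>Only the first block contains \<open>m\<close>. There
    \<open>w = \<sigma> m\<close>, so \<open>m\<close> is the last point of the cycle and receives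
    the last label, which is \<open>m\<close>.\<close>
  have "\<psi> m = m"
  proof (cases "i = Suc m")
    case True
    then have "\<sigma> (\<psi> m) = \<sigma> m" using last w(4) by simp
    then show ?thesis using permutes_inj[OF \<sigma>] by (simp add: inj_eq)
  next
    case False
    then show ?thesis using permutes_not_in[OF \<psi>(1), of m] im by simp
  qed
  \<comment> \<open>For \<open>i = Suc m\<close> the bound is \<open>m\<close>, so this covers just
    the root; it makes \<open>\<theta> w\<close> a fixed point of \<open>\<psi>\<close> in every
    step.\<close>
  have fixed: "\<psi> x = x" if "min i m \<le> x" "x \<le> m" for x
    using permutes_not_in[OF \<psi>(1), of x] \<open>\<psi> m = m\<close> that by (cases "i \<le> x") (auto simp: min_def split: if_splits)
  have \<psi>': "\<psi> permutes {1..m}" using \<psi>(1) im by (auto intro: permutes_subset)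
  define \<sigma>' \<theta>' where "\<sigma>' = inv' \<psi> \<circ> \<sigma> \<circ> \<psi>" and "\<theta>' = inv' \<psi> \<circ> \<theta> \<circ> \<psi>"
  have conj: "\<sigma> (\<psi> x) = \<psi> (\<sigma>' x)" "\<theta> (\<psi> x) = \<psi> (\<theta>' x)" for x
    using conjugate_apply[OF \<psi>(1)] by (simp_all add: \<sigma>'_def \<theta>'_def)
  have old: "(block_step m \<sigma>' \<theta>')\<^sup>*\<^sup>* (Suc m) i"
    using block_steps_conjugate[OF \<theta> \<psi>(1) \<open>\<psi> m = m\<close> conj steps] .
  have \<psi>u: "\<psi> u = w" using \<psi>_shift[of 0] l(1) by simp
  have \<theta>w: "\<theta> w \<le> m" using permutes_in_image[OF \<theta>, of w] w(1) im by auto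
  have \<theta>'u: "\<theta>' u = \<theta> w"
    using conj(2)[of u] \<psi>u fixed[OF w(3) \<theta>w] inj by metis
  have "block_step m \<sigma>' \<theta>' i u"
    unfolding block_step_def
  proof (intro conjI allI ballI impI)
    fix x assume x: "u \<le> x" "Suc x < i"
    then have "\<sigma> (\<psi> x) = \<psi> (Suc x)"
      using \<psi>_shift[of "x - u"] \<psi>_shift[of "Suc x - u"] u(3) by (simp add: Suc_diff_le)
    then show "\<sigma>' x = Suc x" using conj(1)[of x] inj by simp
  next
    show "\<sigma>' (i - 1) = u" using conj(1)[of "i - 1"] last \<psi>u inj by metis
  next
    fix x assume x: "x \<in> {1..<i}"
    show "\<theta>' x \<le> \<theta>' u"
    proof (cases "min i m \<le> \<theta>' x")
      case True
      have "\<theta>' permutes {1..m}" unfolding \<theta>'_def by (intro permutes_conjugate \<theta> \<psi>')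
      then have "\<theta>' x \<le> m" using permutes_in_image[of \<theta>' "{1..m}" x] x im by auto
      then have "\<theta>' x = \<theta> (\<psi> x)" using conj(2)[of x] fixed[OF True] by simp
      then show ?thesis using w(2) permutes_in_image[OF \<psi>(1), of x] x \<theta>'u by simp
    next
      case False
      then show ?thesis using \<theta>'u w(3) by simp
    qed
  qed (use u im \<theta>'u w(3) in auto)
  then have "(block_step m \<sigma>' \<theta>')\<^sup>*\<^sup>* (Suc m) u" using old by (meson rtranclp.rtrancl_into_rtrancl)
  then show ?thesis using that[OF \<psi>' \<open>\<psi> m = m\<close> u(2)] by (simp add: \<sigma>'_def \<theta>'_def)
qed

lemma exists_canonical_conjugate:
  assumes m: "1 \<le> m" and "\<sigma> permutes {1..m}" "\<theta> permutes {1..m}" "\<theta> (\<sigma> m) = m"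
    "connected_on {1..m} \<sigma> \<theta>"
  shows "\<exists>\<phi>. \<phi> permutes {1..m} \<and> \<phi> m = m \<and>
    (block_step m (inv' \<phi> \<circ> \<sigma> \<circ> \<phi>) (inv' \<phi> \<circ> \<theta> \<circ> \<phi>))\<^sup>*\<^sup>* (Suc m) 1"
proof -
  have "\<exists>\<phi>. \<phi> permutes {1..m} \<and> \<phi> m = m \<and>
    (block_step m (inv' \<phi> \<circ> \<sigma> \<circ> \<phi>) (inv' \<phi> \<circ> \<theta> \<circ> \<phi>))\<^sup>*\<^sup>* (Suc m) 1"
    if "(block_step m \<sigma> \<theta>)\<^sup>*\<^sup>* (Suc m) i" "1 \<le> i" for i
    \<comment> \<open>Strong induction on the lower end \<open>i\<close> of the explored part, for
      all pairs at once since each extension conjugates the pair. The start \<open>i = Suc m\<close>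
      needs no steps.\<close>
    using that assms(2-)
  proof (induction i arbitrary: \<sigma> \<theta> rule: less_induct)
    case (less i)
    show ?case
    proof (cases "i = 1")
      case True
      then show ?thesis using less.prems(1) by (intro exI[of _ id] conjI permutes_id) simp_all
    next
      case False
      then have "1 < i" using less.prems by simp
      then obtain \<psi> u where \<psi>: "\<psi> permutes {1..m}" "\<psi> m = m" and u: "u < i"
        and steps: "(block_step m (inv' \<psi> \<circ> \<sigma> \<circ> \<psi>) (inv' \<psi> \<circ> \<theta> \<circ> \<psi>))\<^sup>*\<^sup>* (Suc m) u"
        using block_steps_extend[OF less.prems(4) m less.prems(3,5,6,1)] by blast
      let ?\<sigma>' = "inv' \<psi> \<circ> \<sigma> \<circ> \<psi>" and ?\<theta>' = "inv' \<psi> \<circ> \<theta> \<circ> \<psi>"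
      have "1 \<le> u" using steps
        by (induction rule: rtranclp_induct) (simp_all add: block_step_def)
      moreover have "?\<theta>' (?\<sigma>' m) = m"
        using less.prems(5) \<psi> by (simp add: permutes_inverses permutes_inv_eq)
      moreover have "connected_on {1..m} ?\<sigma>' ?\<theta>'"
        using less.prems(6) \<psi>(1) by (rule connected_on_conjugate) (rule conjugate_apply[OF \<psi>(1)])+
      ultimately obtain \<phi> where \<phi>: "\<phi> permutes {1..m}" "\<phi> m = m"
        "(block_step m (inv' \<phi> \<circ> ?\<sigma>' \<circ> \<phi>) (inv' \<phi> \<circ> ?\<theta>' \<circ> \<phi>))\<^sup>*\<^sup>* (Suc m) 1"
        using less.IH[OF u steps] permutes_conjugate[OF less.prems(3) \<psi>(1)]
          permutes_conjugate[OF less.prems(4) \<psi>(1)] by blast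
      have "inv' (\<psi> \<circ> \<phi>) = inv' \<phi> \<circ> inv' \<psi>"
        using \<phi>(1) \<psi>(1) by (simp add: o_inv_distrib permutes_bij)
      moreover have "(\<psi> \<circ> \<phi>) m = m" using \<phi> \<psi> by simp
      ultimately show ?thesis
        using \<phi> \<psi> by (intro exI[of _ "\<psi> \<circ> \<phi>"] conjI permutes_compose)
          (simp_all add: comp_assoc del: o_apply)
    qed
  qed
  from this[of "Suc m"] show ?thesis by simp
qed

section \<open>The cycles of the block product\<close>

lemma orbit_block:
  assumes "permutation f" "u < i" "\<And>x. u \<le> x \<Longrightarrow> Suc x < i \<Longrightarrow> f x = Suc x" "f (i - 1) = u"
    "x \<in> {u..<i}"
  shows "orbit f x = {u..<i}"
proof -
  \<comment> \<open>An \<open>orbit\<close> begins with the image of its base point, so from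
    \<open>i - 1\<close> it lists \<open>u\<close>, \<open>u + 1\<close> and so on in increasing
    order.\<close>
  have "orbit f (i - 1) = {u..<i}"
  proof (intro equalityI subsetI)
    have step: "f y \<in> {u..<i}" if "y \<in> {u..<i}" for y
    proof (cases "Suc y < i")
      case False
      then have "y = i - 1" using that by auto
      then show ?thesis using assms(2,4) by simp
    qed (use assms(3) that in auto)
    fix y assume "y \<in> orbit f (i - 1)"
    then show "y \<in> {u..<i}"
      by induction (use step assms(2,4) in auto)
  next
    have "u + j \<in> orbit f (i - 1)" if "u + j < i" for j
      using that
    proof (induction j)
      case 0
      then show ?case using orbit.base[of f "i - 1"] assms(4) by simp
    next
      case (Suc j)
      then show ?case using orbit.step[of "u + j" f "i - 1"] assms(3)[of "u + j"] by simp
    qed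
    then show "y \<in> orbit f (i - 1)" if "y \<in> {u..<i}" for y
      using that le_add_diff_inverse[of u y] by (metis atLeastLessThan_iff)
  qed
  then show ?thesis
    using assms(1,5) orbit_cyclic_eq3 cyclic_on_orbit' by metis
qed

lemma orbit_omr_cycles:
  assumes "x \<in> {1..m}"
  obtains s i where "s \<in> lr_max_indices m \<theta>" "x \<in> {s..<i}"
    "\<forall>y\<in>{s..<i}. orbit (omr_cycles m \<theta>) y = {s..<i}"
    "\<forall>t\<in>lr_max_indices m \<theta>. t < i \<longrightarrow> t \<le> s"
proof -
  have m: "1 \<le> m" using assms by auto
  \<comment> \<open>The block of \<open>x\<close> ends at the next left-to-right maximum index after
    \<open>x\<close>, or at \<open>Suc m\<close> if there is none.\<close>
  let ?T = "{t \<in> insert (Suc m) (lr_max_indices m \<theta>). x < t}"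
  define i where "i = Min ?T"
  have T: "finite ?T" "?T \<noteq> {}" using assms by auto
  have i: "i \<in> insert (Suc m) (lr_max_indices m \<theta>)" "x < i" "\<And>t. t \<in> ?T \<Longrightarrow> i \<le> t"
    using Min_in[OF T] Min_le[OF T(1)] by (auto simp: i_def)
  then have i1: "1 < i" using assms by auto
  let ?s = "prev_lr_max m \<theta> i"
  note s = prev_lr_max[OF m i1, where \<theta> = \<theta>]
  have perm: "permutation (omr_cycles m \<theta>)"
    using omr_cycles_permutes[OF m] permutation_permutes by blast
  have "?s \<le> x" using i(3)[of ?s] s(1,2) by fastforce
  moreover have "orbit (omr_cycles m \<theta>) y = {?s..<i}" if "y \<in> {?s..<i}" for y
    using perm s(2) omr_cycles_block[OF i1 i(1)] that by (rule orbit_block)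
  ultimately show ?thesis using that[of ?s i] s i(2) by simp
qed

text \<open>Each cycle is an interval containing exactly one left-to-right maximum index, namely its
  minimum.\<close>

lemma num_cycles_omr_cycles: "num_cycles m (omr_cycles m \<theta>) = card (lr_max_indices m \<theta>)"
proof -
  let ?L = "lr_max_indices m \<theta>" and ?orb = "orbit (omr_cycles m \<theta>)"
  have "?orb ` {1..m} = ?orb ` ?L"
  proof
    show "?orb ` {1..m} \<subseteq> ?orb ` ?L"
    proof (rule image_subsetI)
      fix x assume "x \<in> {1..m}"
      then obtain s i where s: "s \<in> ?L" "x \<in> {s..<i}" "\<forall>y\<in>{s..<i}. ?orb y = {s..<i}"
        "\<forall>t\<in>?L. t < i \<longrightarrow> t \<le> s"
        by (rule orbit_omr_cycles)
      then have "?orb x = ?orb s" by (metis atLeastLessThan_iff le_less_trans order_refl)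
      then show "?orb x \<in> ?orb ` ?L" using s(1) by blast
    qed
  qed (use lr_max_indices_subset in blast)
  moreover have "inj_on ?orb ?L"
  proof -
    have "Min (?orb s) = s" if "s \<in> ?L" for s
    proof -
      have "s \<in> {1..m}" using that lr_max_indices_subset by blast
      then obtain t i where t: "t \<in> ?L" "s \<in> {t..<i}" "\<forall>y\<in>{t..<i}. ?orb y = {t..<i}"
        "\<forall>r\<in>?L. r < i \<longrightarrow> r \<le> t"
        by (rule orbit_omr_cycles)
      then have "s = t" using that by force
      then show ?thesis using t(2,3) by (auto intro!: Min_eqI)
    qed
    then show ?thesis by (metis inj_onI)
  qed
  ultimately show ?thesis by (simp add: num_cycles_def card_image)
qed

section \<open>The bijection\<close>

text \<open>The first step gives a block start \<open>u\<close> with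
  \<open>\<sigma> (Suc n) = u\<close> and \<open>\<theta> u = Suc n\<close>. These are the
  predecessors needed to undo both deletions.\<close>

lemma block_steps_root:
  assumes "\<theta> permutes {1..Suc n}" "1 \<le> n"
    and steps: "(block_step (Suc n) \<sigma> \<theta>)\<^sup>*\<^sup>* (Suc (Suc n)) 1"
  shows "\<theta> (\<sigma> (Suc n)) = Suc n" "\<sigma> n = Suc n" "\<sigma> (Suc n) \<in> {1..n}"
proof -
  let ?N = "Suc n"
  obtain u where u: "block_step ?N \<sigma> \<theta> (Suc ?N) u" "(block_step ?N \<sigma> \<theta>)\<^sup>*\<^sup>* u 1"
    using steps by (cases rule: converse_rtranclpE) auto
  have top: "\<theta> x = ?N" if "?N \<le> \<theta> x" "x \<in> {1..?N}" for x
    using permutes_in_image[OF assms(1), of x] that by simp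
  have u': "u \<in> {1..?N}" "\<sigma> ?N = u" "\<And>x. u \<le> x \<Longrightarrow> x < ?N \<Longrightarrow> \<sigma> x = Suc x" "\<theta> u = ?N"
    using u(1) top[of u] by (auto simp: block_step_def)
  \<comment> \<open>If the first block were only the root, the next step, which exists as
    \<open>n \<ge> 1\<close>, would need a second point with image \<open>?N\<close>.\<close>
  have "u \<noteq> ?N"
  proof
    assume "u = ?N"
    from u(2) obtain v where "block_step ?N \<sigma> \<theta> ?N v"
      using assms(2) \<open>u = ?N\<close> by (cases rule: converse_rtranclpE) auto
    then have "v < ?N" "\<theta> v = ?N" using top[of v] by (auto simp: block_step_def)
    then show False
      using permutes_inj[OF assms(1)] u'(4) \<open>u = ?N\<close> by (metis injD less_irrefl)
  qed
  then show "\<theta> (\<sigma> ?N) = ?N" "\<sigma> n = ?N" "\<sigma> ?N \<in> {1..n}"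
    using u' by auto
qed

text \<open>The deleted point has predecessor \<open>n\<close> under \<sigma> and
  \<open>\<sigma> (Suc n)\<close> under \<theta>. An invariant set of the deleted pair contains both
  or neither; accordingly it is invariant for the original pair with \<open>Suc n\<close> added or
  as it stands.\<close>

lemma connected_on_delete_point:
  assumes \<sigma>: "\<sigma> permutes {1..Suc n}" and \<theta>: "\<theta> permutes {1..Suc n}"
    and root: "\<sigma> n = Suc n" "\<theta> (\<sigma> (Suc n)) = Suc n"
    and conn: "connected_on {1..Suc n} \<sigma> \<theta>"
  shows "connected_on {1..n} (delete_point (Suc n) \<sigma>) (delete_point (Suc n) \<theta>)"
  unfolding connected_on_def
proof (intro allI impI)
  let ?N = "Suc n"
  let ?s = "delete_point ?N \<sigma>" and ?t = "delete_point ?N \<theta>" and ?d = "\<sigma> (Suc n)"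
  fix A assume A: "A \<subseteq> {1..n}" "A \<noteq> {}" "?s ` A \<subseteq> A" "?t ` A \<subseteq> A"
  have fin: "finite A" using A(1) finite_subset by blast
  have d: "?d = ?s n" using root(1) by (simp add: delete_point_def)
  then have dA: "?d \<in> A \<longleftrightarrow> n \<in> A"
    using permutes_invariant_iff[OF delete_point_permutes[OF \<sigma>] fin A(3)] by simp
  have \<sigma>_eq: "\<sigma> x = (if x = n then ?N else ?s x)" if "x \<noteq> ?N" for x
    using root(1) that inj_eq[OF permutes_inj[OF \<sigma>], of x n] by (simp add: delete_point_def)
  have \<theta>_eq: "\<theta> x = (if x = ?d then ?N else ?t x)" if "x \<noteq> ?N" for x
    using root(2) that inj_eq[OF permutes_inj[OF \<theta>], of x ?d] by (simp add: delete_point_def)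
  have N: "?N \<notin> A" using A(1) by auto
  show "A = {1..n}"
  proof (cases "n \<in> A")
    case True
    have "?d \<noteq> ?N" using True dA N by auto
    then have "\<theta> ?N = ?t ?d" using root(2) by (simp add: delete_point_def)
    then have "\<theta> ?N \<in> A" using True dA A(4) by auto
    moreover have "\<sigma> x \<in> insert ?N A" "\<theta> x \<in> insert ?N A" if "x \<in> A" for x
    proof -
      have "x \<noteq> ?N" "?s x \<in> A" "?t x \<in> A" using that N A(3,4) by auto
      then show "\<sigma> x \<in> insert ?N A" "\<theta> x \<in> insert ?N A"
        using \<sigma>_eq[of x] \<theta>_eq[of x] by auto
    qed
    ultimately have "\<sigma> ` insert ?N A \<subseteq> insert ?N A" "\<theta> ` insert ?N A \<subseteq> insert ?N A"
      using True dA by auto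
    moreover have "insert ?N A \<subseteq> {1..?N}" using A(1) by auto
    ultimately have "insert ?N A = {1..?N}"
      using conn[unfolded connected_on_def, rule_format, of "insert ?N A"] by simp
    moreover have "A = insert ?N A - {?N}" using N by simp
    ultimately have "A = {1..?N} - {?N}" by simp
    then show ?thesis by auto
  next
    case False
    have "\<sigma> x = ?s x" "\<theta> x = ?t x" if "x \<in> A" for x
    proof -
      have "x \<noteq> n" "x \<noteq> ?d" "x \<noteq> ?N" using False dA N that by auto
      then show "\<sigma> x = ?s x" "\<theta> x = ?t x" using \<sigma>_eq[of x] \<theta>_eq[of x] by simp_all
    qed
    then have "\<sigma> ` A \<subseteq> A" "\<theta> ` A \<subseteq> A" using A(3,4) by auto
    moreover have "A \<subseteq> {1..?N}" using A(1) by auto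
    ultimately have "A = {1..?N}"
      using conn[unfolded connected_on_def, rule_format, of A] A(2) by simp
    then show ?thesis using N by simp
  qed
qed

text \<open>Removing \<open>Suc n\<close> from an invariant set leaves a set invariant under the
  deleted pair, nonempty because \<sigma> moves \<open>Suc n\<close>. It is then all of
  \<open>{1..n}\<close>, and \<open>n\<close> brings \<open>Suc n\<close> back.\<close>

lemma connected_on_insert_point:
  assumes \<sigma>: "\<sigma> permutes {1..Suc n}" and \<theta>: "\<theta> permutes {1..Suc n}"
    and root: "\<sigma> n = Suc n" and n: "1 \<le> n"
    and conn: "connected_on {1..n} (delete_point (Suc n) \<sigma>) (delete_point (Suc n) \<theta>)"
  shows "connected_on {1..Suc n} \<sigma> \<theta>"
  unfolding connected_on_def
proof (intro allI impI)
  let ?N = "Suc n"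
  fix A assume A: "A \<subseteq> {1..?N}" "A \<noteq> {}" "\<sigma> ` A \<subseteq> A" "\<theta> ` A \<subseteq> A"
  have closed: "delete_point ?N p ` (A - {?N}) \<subseteq> A - {?N}"
    if "p permutes {1..?N}" "p ` A \<subseteq> A" for p
  proof
    fix y assume "y \<in> delete_point ?N p ` (A - {?N})"
    then obtain x where x: "x \<in> A" "x \<noteq> ?N" "y = delete_point ?N p x" by blast
    then have "p x \<in> A" "p x = ?N \<Longrightarrow> p ?N \<in> A" using that(2) by (auto, metis imageI subsetD)
    moreover have "p ?N \<noteq> ?N" if "p x = ?N"
      using \<open>p permutes {1..?N}\<close> x(2) that by (metis injD permutes_inj)
    ultimately show "y \<in> A - {?N}" using x by (auto simp: delete_point_def)
  qed
  have "A - {?N} \<noteq> {}"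
  proof (cases "?N \<in> A")
    case True
    moreover have "\<sigma> ?N \<noteq> ?N" using root permutes_inj[OF \<sigma>] by (metis injD n_not_Suc_n)
    ultimately show ?thesis using A(3) by blast
  qed (use A(2) in auto)
  moreover have "A - {?N} \<subseteq> {1..n}" using A(1) by auto
  ultimately have eq: "A - {?N} = {1..n}"
    using conn closed[OF \<sigma> A(3)] closed[OF \<theta> A(4)] unfolding connected_on_def by blast
  have "n \<in> A - {?N}" unfolding eq using n by simp
  then have "?N \<in> A" using A(3) root by (metis DiffD1 imageI subsetD)
  then have "A = insert ?N (A - {?N})" by (simp add: insert_absorb)
  also have "\<dots> = {1..?N}" unfolding eq by auto
  finally show "A = {1..?N}" .
qed

lemma indecomposablesD:
  assumes "\<theta> \<in> indecomposables m" "1 \<le> m"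
  shows "\<theta> permutes {1..m}" "(block_step m (omr_cycles m \<theta>) \<theta>)\<^sup>*\<^sup>* (Suc m) 1"
  using assms block_steps_omr_cycles[of \<theta> m]
  by (auto simp: indecomposables_def sym_group_carrier)

lemma Psi_hypermap:
  assumes "1 \<le> n" "\<theta> \<in> indecomposables (Suc n)"
  shows "Psi n \<theta> \<in> hypermaps n"
proof -
  let ?\<sigma> = "omr_cycles (Suc n) \<theta>"
  have \<theta>: "\<theta> permutes {1..Suc n}" "(block_step (Suc n) ?\<sigma> \<theta>)\<^sup>*\<^sup>* (Suc (Suc n)) 1"
    using indecomposablesD[OF assms(2)] by simp_all
  have \<sigma>: "?\<sigma> permutes {1..Suc n}" by (rule omr_cycles_permutes) simp
  have "connected_on {1..Suc n} ?\<sigma> \<theta>"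
    using \<sigma> \<theta> by (intro block_steps_connected) auto
  then show ?thesis
    using connected_on_delete_point[OF \<sigma> \<theta>(1)] block_steps_root[OF \<theta>(1) assms(1) \<theta>(2)]
      delete_point_permutes[OF \<sigma>] delete_point_permutes[OF \<theta>(1)]
    by (simp add: Psi_def hypermaps_iff_connected_on)
qed

lemma Psi_num_cycles:
  assumes "1 \<le> n" "\<theta> \<in> indecomposables (Suc n)" "Psi n \<theta> = (\<sigma>, \<alpha>)"
  shows "num_cycles n \<alpha> = num_cycles (Suc n) \<theta>"
    and "num_cycles n \<sigma> = card (lr_max_indices (Suc n) \<theta>)"
proof -
  let ?\<sigma> = "omr_cycles (Suc n) \<theta>"
  have \<theta>: "\<theta> permutes {1..Suc n}" "(block_step (Suc n) ?\<sigma> \<theta>)\<^sup>*\<^sup>* (Suc (Suc n)) 1"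
    using indecomposablesD[OF assms(2)] by simp_all
  have \<sigma>: "?\<sigma> permutes {1..Suc n}" by (rule omr_cycles_permutes) simp
  note root = block_steps_root[OF \<theta>(1) assms(1) \<theta>(2)]
  have "?\<sigma> (Suc n) \<noteq> Suc n" using root(3) by auto
  moreover have "\<theta> (Suc n) \<noteq> Suc n"
    using root(1) calculation permutes_inj[OF \<theta>(1)] by (metis injD)
  ultimately show "num_cycles n \<alpha> = num_cycles (Suc n) \<theta>"
    "num_cycles n \<sigma> = card (lr_max_indices (Suc n) \<theta>)"
    using assms(3) num_cycles_delete_point[OF \<theta>(1)] num_cycles_delete_point[OF \<sigma>]
    by (auto simp: Psi_def num_cycles_omr_cycles)
qed

lemma transpose_conjugate:
  assumes "inj \<phi>"
  shows "transpose (\<phi> a) (\<phi> b) (\<phi> x) = \<phi> (transpose a b x)"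
  using inj_eq[OF assms] by (simp add: transpose_def)

text \<open>A rooted isomorphism, extended by fixing \<open>Suc n\<close>, conjugates the undeleted
  pairs because it respects the insertion points; rigidity makes it the identity.\<close>

lemma Psi_inj:
  assumes n: "1 \<le> n" and "\<theta> \<in> indecomposables (Suc n)" "\<theta>' \<in> indecomposables (Suc n)"
    and iso: "(Psi n \<theta>, Psi n \<theta>') \<in> rooted_iso n"
  shows "\<theta> = \<theta>'"
proof -
  let ?N = "Suc n"
  define \<sigma> \<sigma>' where "\<sigma> = omr_cycles ?N \<theta>" and "\<sigma>' = omr_cycles ?N \<theta>'"
  have \<theta>: "\<theta> permutes {1..?N}" "(block_step ?N \<sigma> \<theta>)\<^sup>*\<^sup>* (Suc ?N) 1"
    and \<theta>': "\<theta>' permutes {1..?N}" "(block_step ?N \<sigma>' \<theta>')\<^sup>*\<^sup>* (Suc ?N) 1"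
    unfolding \<sigma>_def \<sigma>'_def
    by (rule indecomposablesD[OF assms(2)] indecomposablesD[OF assms(3)]; simp)+
  have \<sigma>: "\<sigma> permutes {1..?N}" and \<sigma>': "\<sigma>' permutes {1..?N}"
    unfolding \<sigma>_def \<sigma>'_def by (rule omr_cycles_permutes; simp)+
  note root = block_steps_root[OF \<theta>(1) n \<theta>(2)] and root' = block_steps_root[OF \<theta>'(1) n \<theta>'(2)]
  let ?d = "delete_point ?N"
  obtain \<phi> where \<phi>: "\<phi> permutes {1..n}" "\<phi> n = n"
    and eq: "?d \<theta>' = inv' \<phi> \<circ> ?d \<theta> \<circ> \<phi>" "?d \<sigma>' = inv' \<phi> \<circ> ?d \<sigma> \<circ> \<phi>"
    using iso by (auto simp: rooted_iso_def Psi_def sym_group_carrier \<sigma>_def \<sigma>'_def)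
  have \<phi>N: "\<phi> ?N = ?N" using permutes_not_in[OF \<phi>(1), of ?N] by simp
  have inj: "inj \<phi>" using permutes_inj[OF \<phi>(1)] .
  have d: "?d \<theta> (\<phi> x) = \<phi> (?d \<theta>' x)" "?d \<sigma> (\<phi> x) = \<phi> (?d \<sigma>' x)" for x
    using conjugate_apply[OF \<phi>(1)] eq by metis+
  have \<sigma>_conj: "\<sigma> (\<phi> x) = \<phi> (\<sigma>' x)" for x
  proof -
    have "\<sigma> (\<phi> x) = ?d \<sigma> (transpose (\<phi> n) (\<phi> ?N) (\<phi> x))"
      using insert_point[OF permutes_inj[OF \<sigma>] root(2)] \<phi>(2) \<phi>N by (metis comp_apply)
    also have "\<dots> = \<phi> (?d \<sigma>' (transpose n ?N x))"
      by (simp only: transpose_conjugate[OF inj] d)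
    also have "\<dots> = \<phi> (\<sigma>' x)"
      using insert_point[OF permutes_inj[OF \<sigma>'] root'(2)] by (metis comp_apply)
    finally show ?thesis .
  qed
  \<comment> \<open>The insertion point for \<theta> is \<open>\<sigma> ?N\<close>, so this rests on
    the conjugation of \<sigma> just obtained.\<close>
  have "\<theta> (\<phi> x) = \<phi> (\<theta>' x)" for x
  proof -
    have "\<phi> (\<sigma>' ?N) = \<sigma> ?N" using \<sigma>_conj[of ?N] \<phi>N by simp
    then have "\<theta> (\<phi> x) = ?d \<theta> (transpose (\<phi> (\<sigma>' ?N)) (\<phi> ?N) (\<phi> x))"
      using insert_point[OF permutes_inj[OF \<theta>(1)] root(1)] \<phi>N by (metis comp_apply)
    also have "\<dots> = \<phi> (?d \<theta>' (transpose (\<sigma>' ?N) ?N x))"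
      by (simp only: transpose_conjugate[OF inj] d)
    also have "\<dots> = \<phi> (\<theta>' x)"
      using insert_point[OF permutes_inj[OF \<theta>'(1)] root'(1)] by (metis comp_apply)
    finally show ?thesis .
  qed
  moreover have "\<phi> permutes {1..?N}" using \<phi>(1) by (rule permutes_subset) auto
  ultimately have "\<phi> = id"
    using block_steps_rigid[OF \<theta>(1) _ _ \<phi>N \<sigma>_conj _ \<theta>(2) \<theta>'(2)] by simp
  then show ?thesis using \<open>\<And>x. \<theta> (\<phi> x) = \<phi> (\<theta>' x)\<close> by (simp add: fun_eq_iff)
qed

lemma Psi_surj:
  assumes n: "1 \<le> n" and h: "(\<sigma>, \<alpha>) \<in> hypermaps n"
  obtains \<theta> where "\<theta> \<in> indecomposables (Suc n)" "((\<sigma>, \<alpha>), Psi n \<theta>) \<in> rooted_iso n"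
proof -
  let ?N = "Suc n"
  let ?d = "delete_point ?N"
  have \<sigma>: "\<sigma> permutes {1..n}" and \<alpha>: "\<alpha> permutes {1..n}" and conn: "connected_on {1..n} \<sigma> \<alpha>"
    using h by (simp_all add: hypermaps_iff_connected_on)
  have \<sigma>n: "\<sigma> n \<in> {1..n}" using permutes_in_image[OF \<sigma>, of n] n by simp
  \<comment> \<open>These insertions are forced by \<open>block_steps_root\<close>:
    \<open>?N\<close> goes after \<open>n\<close> in \<sigma> and after \<open>\<sigma> n\<close>,
    the new image of \<open>?N\<close>, in \<alpha>.\<close>
  define \<sigma>\<^sub>1 \<theta>\<^sub>1 where "\<sigma>\<^sub>1 = \<sigma> \<circ> transpose n ?N" and "\<theta>\<^sub>1 = \<alpha> \<circ> transpose (\<sigma> n) ?N"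
  have "\<sigma> permutes {1..?N}" "\<alpha> permutes {1..?N}"
    by (rule permutes_subset[OF \<sigma>] permutes_subset[OF \<alpha>]; simp)+
  then have \<sigma>\<^sub>1: "\<sigma>\<^sub>1 permutes {1..?N}" and \<theta>\<^sub>1: "\<theta>\<^sub>1 permutes {1..?N}"
    unfolding \<sigma>\<^sub>1_def \<theta>\<^sub>1_def using n \<sigma>n
    by (auto intro!: permutes_compose permutes_swap_id)
  have del: "?d \<sigma>\<^sub>1 = \<sigma>" "?d \<theta>\<^sub>1 = \<alpha>"
    using delete_point_insert[OF \<sigma>, of n] delete_point_insert[OF \<alpha> \<sigma>n] n
    by (simp_all add: \<sigma>\<^sub>1_def \<theta>\<^sub>1_def)
  have "\<sigma>\<^sub>1 n = ?N" using permutes_not_in[OF \<sigma>, of ?N] by (simp add: \<sigma>\<^sub>1_def)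
  moreover have root: "\<theta>\<^sub>1 (\<sigma>\<^sub>1 ?N) = ?N"
    using permutes_not_in[OF \<alpha>, of ?N] by (simp add: \<sigma>\<^sub>1_def \<theta>\<^sub>1_def)
  ultimately have "connected_on {1..?N} \<sigma>\<^sub>1 \<theta>\<^sub>1"
    using connected_on_insert_point[OF \<sigma>\<^sub>1 \<theta>\<^sub>1 _ n] conn del by simp
  then obtain \<phi> where \<phi>: "\<phi> permutes {1..?N}" "\<phi> ?N = ?N"
    and steps: "(block_step ?N (inv' \<phi> \<circ> \<sigma>\<^sub>1 \<circ> \<phi>) (inv' \<phi> \<circ> \<theta>\<^sub>1 \<circ> \<phi>))\<^sup>*\<^sup>* (Suc ?N) 1"
    using exists_canonical_conjugate[OF _ \<sigma>\<^sub>1 \<theta>\<^sub>1 root] by auto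
  let ?\<sigma> = "inv' \<phi> \<circ> \<sigma>\<^sub>1 \<circ> \<phi>" and ?\<theta> = "inv' \<phi> \<circ> \<theta>\<^sub>1 \<circ> \<phi>"
  have perms: "?\<sigma> permutes {1..?N}" "?\<theta> permutes {1..?N}"
    by (intro permutes_conjugate \<sigma>\<^sub>1 \<theta>\<^sub>1 \<phi>(1))+
  have ind: "?\<theta> \<in> indecomposables ?N"
    using perms(2) block_steps_indecomposable[OF steps]
    by (simp add: indecomposables_def sym_group_carrier)
  have omr: "omr_cycles ?N ?\<theta> = ?\<sigma>"
    using block_steps_imp_omr_cycles[OF perms _ steps] by simp
  have "Psi n ?\<theta> = (inv' \<phi> \<circ> \<sigma> \<circ> \<phi>, inv' \<phi> \<circ> \<alpha> \<circ> \<phi>)"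
    using delete_point_conjugate[OF permutes_bij[OF \<phi>(1)] \<phi>(2)] del
    by (simp add: Psi_def omr)
  moreover have "\<phi> permutes {1..n}"
    using \<phi> by (elim permutes_superset) (auto simp: le_Suc_eq)
  \<comment> \<open>The canonical relabelling is only known to fix \<open>?N\<close>. It also fixes
    \<open>n\<close>, since both \<open>\<sigma>\<^sub>1\<close> and its conjugate send
    \<open>n\<close> to \<open>?N\<close>.\<close>
  moreover have "\<phi> n = n"
  proof -
    have "\<sigma>\<^sub>1 (\<phi> n) = \<phi> (?\<sigma> n)" using conjugate_apply[OF \<phi>(1)] .
    also have "\<dots> = \<sigma>\<^sub>1 n"
      using block_steps_root(2)[OF perms(2) n steps] \<phi>(2) \<open>\<sigma>\<^sub>1 n = ?N\<close> by simp
    finally show ?thesis using permutes_inj[OF \<sigma>\<^sub>1] by (simp add: inj_eq)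
  qed
  ultimately have "((\<sigma>, \<alpha>), Psi n ?\<theta>) \<in> rooted_iso n"
    using h Psi_hypermap[OF n ind] by (auto simp: rooted_iso_def sym_group_carrier)
  then show ?thesis using that ind by blast
qed

theorem theorem1:
  fixes n :: nat
  assumes "n \<ge> 1"
  shows "(\<forall>\<theta> \<in> indecomposables (n + 1). Psi n \<theta> \<in> hypermaps n) \<and>
    bij_betw (\<lambda>\<theta>. rooted_iso n `` {Psi n \<theta>}) (indecomposables (n + 1)) (rooted_hypermaps n) \<and>
    (\<forall>\<theta> \<in> indecomposables (n + 1). \<forall>\<sigma> \<alpha>. Psi n \<theta> = (\<sigma>, \<alpha>) \<longrightarrow>
       num_cycles n \<alpha> = num_cycles (n + 1) \<theta> \<and>
       num_cycles n \<sigma> = card (lr_max_indices (n + 1) \<theta>))"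
proof -
  let ?class = "\<lambda>\<theta>. rooted_iso n `` {Psi n \<theta>}" and ?I = "indecomposables (Suc n)"
  have "inj_on ?class ?I"
  proof (rule inj_onI)
    fix \<theta> \<theta>' assume "\<theta> \<in> ?I" "\<theta>' \<in> ?I" "?class \<theta> = ?class \<theta>'"
    then show "\<theta> = \<theta>'"
      using Psi_inj[OF assms] Psi_hypermap[OF assms] eq_equiv_class[OF _ equiv_rooted_iso] by blast
  qed
  moreover have "?class ` ?I = rooted_hypermaps n"
  proof
    show "?class ` ?I \<subseteq> rooted_hypermaps n"
      using Psi_hypermap[OF assms] by (auto simp: rooted_hypermaps_def intro: quotientI)
    show "rooted_hypermaps n \<subseteq> ?class ` ?I"
    proof
      fix C assume "C \<in> rooted_hypermaps n"
      then obtain \<sigma> \<alpha> where h: "(\<sigma>, \<alpha>) \<in> hypermaps n" "C = rooted_iso n `` {(\<sigma>, \<alpha>)}"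
        by (auto simp: rooted_hypermaps_def elim!: quotientE)
      obtain \<theta> where "\<theta> \<in> ?I" "((\<sigma>, \<alpha>), Psi n \<theta>) \<in> rooted_iso n"
        using assms h(1) by (rule Psi_surj)
      then show "C \<in> ?class ` ?I"
        using h(2) equiv_class_eq[OF equiv_rooted_iso] by blast
    qed
  qed
  ultimately show ?thesis
    using Psi_hypermap[OF assms] Psi_num_cycles[OF assms] by (simp add: bij_betw_def)
qed

end
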